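(* Let $h_1(t)=e^{i\omega_1 t}$ and $h_2(t)=e^{i\omega_2 t}$. If $\omega_1\neq\omega_2$ and $\omega_1,\omega_2\neq 0$, then the solution $u$ to the system $$\begin{cases} \Delta u(x,t) = f_1(x) h_1(t) & \text{in } \Omega_1\times \mathbb{R}^+,\\ \Delta u(x,t) = f_2(x) h_2(t) & \text{in } \Omega_2\times \mathbb{R}^+,\\ \nabla\cdot(\sigma(x)+\varepsilon(x)\partial_t)\nabla u(x,t)=0 & \text{in } (\mathbb{R}^2\setminus\overline{\Omega_1\cup\Omega_2})\times\mathbb{R}^+,\\ u|_+-u|_-=\xi_1\,\frac{\partial u}{\partial\nu}\big|_+ & \text{on } \partial\Omega_1\times\mathbb{R}^+,\\ u|_+-u|_-=\xi_2\,\frac{\partial u}{\partial\nu}\big|_+ & \text{on } \partial\Omega_2\times\mathbb{R}^+,\\ \frac{\partial u}{\partial\nu}\big|_-=0 & \text{on } \partial\Omega_1\times\mathbb{R}^+ \text{ and } \partial\Omega_2\times\mathbb{R}^+,\\ |u(x,t)|=O(|x|^{-1}) & \text{as } |x|\to\infty,\ t\in\mathbb{R}^+,\end{cases}$$ can be represented as $$u(x,t)=u_1(x)e^{i\omega_1 t}+u_2(x)e^{i\omega_2 t},$$ where $u_1,u_2$ satisfy the following transmission problems: $$\begin{cases} \Delta u_1(x)=f_1(x) & \text{in }\Omega_1,\\ \Delta u_1(x)=0 & \text{in }\Omega_2,\\ \nabla\cdot(\sigma(x)+i\omega_1\varepsilon(x))\nabla u_1(x)=0 & \text{in }\mathbb{R}^2\setminus\overline{\Omega_1\cup\Omega_2},\\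 u_1|_+-u_1|_-=\xi_1\,\frac{\partial u_1}{\partial\nu}\big|_+ & \text{on }\partial\Omega_1,\\ u_1|_+-u_1|_-=\xi_2\,\frac{\partial u_1}{\partial\nu}\big|_+ & \text{on }\partial\Omega_2,\\ \frac{\partial u_1}{\partial\nu}\big|_-=0 & \text{on }\partial\Omega_1 \text{ and } \partial\Omega_2,\\ |u_1(x)|=O(|x|^{-1}) & \text{as }|x|\to\infty,\end{cases}$$ and $$\begin{cases} \Delta u_2(x)=0 & \text{in }\Omega_1,\\ \Delta u_2(x)=f_2(x) & \text{in }\Omega_2,\\ \nabla\cdot(\sigma(x)+i\omega_2\varepsilon(x))\nabla u_2(x)=0 & \text{in }\mathbb{R}^2\setminus\overline{\Omega_1\cup\Omega_2},\\ u_2|_+-u_2|_-=\xi_1\,\frac{\partial u_2}{\partial\nu}\big|_+ & \text{on }\partial\Omega_1,\\ u_2|_+-u_2|_-=\xi_2\,\frac{\partial u_2}{\partial\nu}\big|_+ & \text{on }\partial\Omega_2,\\ \frac{\partial u_2}{\partial\nu}\big|_-=0 & \text{on }\partial\Omega_1 \text{ and } \partial\Omega_2,\\ |u_2(x)|=O(|x|^{-1}) & \text{as }|x|\to\infty.\end{cases}$$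
   Context: Setting: $\Omega_1,\Omega_2\subset\mathbb{R}^2$ are the bodies of two weakly electric fish $\mathfrak{F}_1,\mathfrak{F}_2$; each is a simply connected bounded domain of class $C^{2,\alpha}$ for some $0<\alpha<1$, and they are disjoint. The numbers $\omega_1,\omega_2$ are the fundamental (real) frequencies of the electric organ discharges of $\mathfrak{F}_1$ and $\mathfrak{F}_2$. The functions $\sigma(x)$ and $\varepsilon(x)$ are the (time-independent) conductivity and electric permittivity of the medium outside the fish, which may contain a target $D$ with material parameters $\sigma_0,\varepsilon_0$. The constants $\xi_1,\xi_2$ are the effective skin thickness parameters of $\mathfrak{F}_1,\mathfrak{F}_2$. Sources: for $i=1,2$, $f_i=\sum_{j=1}^{2}\alpha^{(i)}_j\,\delta_{x^{(i)}_j}$ is a dipole, where $\delta_{x}$ is the Dirac mass at $x$, the points $x^{(i)}_j$ lie inside $\Omega_i$, and the local charge neutrality condition $\alpha^{(i)}_1+\alpha^{(i)}_2=0$ holds. Notation: $\mathbb{R}^+$ is the time axis; $\nu$ denotes the outward unit normal to $\partial\Omega_1$ or $\partial\Omega_2$. For a function $w$ defined off the boundary and $x$ on the boundary, $$w(x)|_{\pm}:=\lim_{t\to0}w(x\pm t\nu(x)),\qquad \frac{\partial w}{\partial\nu}(x)\Big|_{\pm}:=\lim_{t\to0}\nabla w(x\pm t\nu(x))\cdot\nu(x),$$ with the limit in $t>0$, so $+$ denotes the limit from outside and $-$ from inside. The operators $\Delta,\nabla$ act in the space variable $x$. The expression $\nabla\cdot(\sigma+\varepsilon\partial_t)\nabla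 u$ means $\nabla\cdot(\sigma\nabla u+\varepsilon\,\partial_t\nabla u)$.
   Formalization: The system has no initial condition and its solution is not unique (for constant σ, ε add v(x)e^{-σt/ε}, v compactly supported outside the fish). "The solution u" is read as the unique solution in a given complex vector space of functions closed under forward time shifts. *)

theory Defs
  imports "HOL-Analysis.Analysis" "HOL-Library.Landau_Symbols"
begin

section \<open>Domains of class C(2,alpha) and their outward normal\<close>

text \<open>
  Near each boundary point p, in a suitable orthonormal frame (a, b) centred at p, the set is the
  strict epigraph of a function g whose second derivative is Hoelder continuous.
\<close>

definition C2_holder_boundary :: "real \<Rightarrow> (real^2) set \<Rightarrow> bool" where
  "C2_holder_boundary \<alpha> S \<longleftrightarrow>
     (\<forall>p\<in>frontier S. \<exists>a b r C. \<exists>g g' g'' :: real \<Rightarrow> real.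
        norm a = 1 \<and> norm b = 1 \<and> a \<bullet> b = 0 \<and> r > 0 \<and>
        (\<forall>s. \<bar>s\<bar> < r \<longrightarrow> (g has_real_derivative g' s) (at s) \<and>
                      (g' has_real_derivative g'' s) (at s)) \<and>
        (\<forall>s s'. \<bar>s\<bar> < r \<longrightarrow> \<bar>s'\<bar> < r \<longrightarrow> \<bar>g'' s - g'' s'\<bar> \<le> C * \<bar>s - s'\<bar> powr \<alpha>) \<and>
        (\<forall>x\<in>ball p r. x \<in> S \<longleftrightarrow> (x - p) \<bullet> b > g ((x - p) \<bullet> a)))"

definition fish_body :: "(real^2) set \<Rightarrow> bool" where
  "fish_body S \<longleftrightarrow>
     open S \<and> connected S \<and> S \<noteq> {} \<and> bounded S \<and> simply_connected S \<and>
     (\<exists>\<alpha>. 0 < \<alpha> \<and> \<alpha> < 1 \<and> C2_holder_boundary \<alpha> S)"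

text \<open>
  The unit vector orthogonal to the boundary at x that points out of S. The limit says that n is
  orthogonal to the tangent line; it determines n up to sign when the boundary is a C1 curve.
\<close>

definition outward_normal :: "(real^2) set \<Rightarrow> real^2 \<Rightarrow> real^2" where
  "outward_normal S x = (THE n. norm n = 1 \<and>
     ((\<lambda>y. ((y - x) \<bullet> n) / norm (y - x)) \<longlongrightarrow> 0) (at x within frontier S) \<and>
     (\<forall>\<^sub>F s in at_right 0. x - s *\<^sub>R n \<in> S \<and> x + s *\<^sub>R n \<notin> closure S))"


section \<open>Weak formulations of the differential equations\<close>

definition partial :: "2 \<Rightarrow> (real^2 \<Rightarrow> real) \<Rightarrow> real^2 \<Rightarrow> real" where
  "partial j \<phi> x = frechet_derivative \<phi> (at x) (axis j 1)"

definition laplacian :: "(real^2 \<Rightarrow> real) \<Rightarrow> real^2 \<Rightarrow> real" where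
  "laplacian \<phi> x = (\<Sum>j\<in>UNIV. partial j (partial j \<phi>) x)"

primrec Ck :: "nat \<Rightarrow> (real^2 \<Rightarrow> real) \<Rightarrow> bool" where
  "Ck 0 \<phi> \<longleftrightarrow> continuous_on UNIV \<phi>"
| "Ck (Suc n) \<phi> \<longleftrightarrow> (\<forall>x. \<phi> differentiable (at x)) \<and> (\<forall>j. Ck n (partial j \<phi>))"

definition test_functions :: "(real^2) set \<Rightarrow> (real^2 \<Rightarrow> real) set" where
  "test_functions S =
     {\<phi>. (\<forall>n. Ck n \<phi>) \<and> compact (closure {x. \<phi> x \<noteq> 0}) \<and> closure {x. \<phi> x \<noteq> 0} \<subseteq> S}"

text \<open>A distribution is represented by its action on test functions.\<close>

type_synonym distribution = "(real^2 \<Rightarrow> real) \<Rightarrow> complex"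

definition dirac :: "real^2 \<Rightarrow> distribution" where
  "dirac x \<phi> = of_real (\<phi> x)"

definition dipole :: "(nat \<Rightarrow> complex) \<Rightarrow> (nat \<Rightarrow> real^2) \<Rightarrow> distribution" where
  "dipole \<alpha> p \<phi> = (\<Sum>j=1..2. \<alpha> j * dirac (p j) \<phi>)"

definition L1_loc_on :: "(real^2) set \<Rightarrow> (real^2 \<Rightarrow> 'b::euclidean_space) \<Rightarrow> bool" where
  "L1_loc_on S g \<longleftrightarrow> (\<forall>K. compact K \<longrightarrow> K \<subseteq> S \<longrightarrow> g absolutely_integrable_on K)"

definition L2_loc_on :: "(real^2) set \<Rightarrow> (real^2 \<Rightarrow> 'b::euclidean_space) \<Rightarrow> bool" where
  "L2_loc_on S g \<longleftrightarrow> L1_loc_on S g \<and> L1_loc_on S (\<lambda>x. (norm (g x))\<^sup>2)"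

definition laplace_eq_on :: "(real^2) set \<Rightarrow> (real^2 \<Rightarrow> complex) \<Rightarrow> distribution \<Rightarrow> bool" where
  "laplace_eq_on S w F \<longleftrightarrow> L1_loc_on S w \<and>
     (\<forall>\<phi>\<in>test_functions S.
        set_lebesgue_integral lebesgue S (\<lambda>x. laplacian \<phi> x *\<^sub>R w x) = F \<phi>)"

definition weak_gradient_on ::
    "(real^2) set \<Rightarrow> (real^2 \<Rightarrow> complex) \<Rightarrow> (real^2 \<Rightarrow> complex^2) \<Rightarrow> bool" where
  "weak_gradient_on S w Dw \<longleftrightarrow> L2_loc_on S w \<and> L2_loc_on S Dw \<and>
     (\<forall>\<phi>\<in>test_functions S. \<forall>j.
        set_lebesgue_integral lebesgue S (\<lambda>x. partial j \<phi> x *\<^sub>R w x) =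
        - set_lebesgue_integral lebesgue S (\<lambda>x. \<phi> x *\<^sub>R (Dw x $ j)))"

text \<open>The weak form of: the divergence of the vector field F vanishes on S.\<close>

definition weak_div_free_on :: "(real^2) set \<Rightarrow> (real^2 \<Rightarrow> complex^2) \<Rightarrow> bool" where
  "weak_div_free_on S F \<longleftrightarrow> L1_loc_on S F \<and>
     (\<forall>\<phi>\<in>test_functions S.
        set_lebesgue_integral lebesgue S (\<lambda>x. \<Sum>j\<in>UNIV. partial j \<phi> x *\<^sub>R (F x $ j)) = 0)"

text \<open>G is the time derivative of D at time t with respect to convergence in L2 on compact sets.\<close>

definition has_L2_loc_time_derivative ::
    "(real^2) set \<Rightarrow> (real \<Rightarrow> real^2 \<Rightarrow> complex^2) \<Rightarrow> real \<Rightarrow> (real^2 \<Rightarrow> complex^2) \<Rightarrow> bool" where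
  "has_L2_loc_time_derivative S D t G \<longleftrightarrow> L2_loc_on S G \<and>
     (\<forall>K. compact K \<longrightarrow> K \<subseteq> S \<longrightarrow>
        ((\<lambda>h. set_lebesgue_integral lebesgue K
            (\<lambda>x. (norm ((1 / h) *\<^sub>R (D (t + h) x - D t x) - G x))\<^sup>2)) \<longlongrightarrow> 0) (at 0))"

definition conduction_time_eq_on ::
    "(real^2) set \<Rightarrow> (real^2 \<Rightarrow> real) \<Rightarrow> (real^2 \<Rightarrow> real) \<Rightarrow> (real^2 \<Rightarrow> real \<Rightarrow> complex) \<Rightarrow> bool" where
  "conduction_time_eq_on S \<sigma> \<epsilon> u \<longleftrightarrow>
     (\<exists>Du dtDu. \<forall>t>0. weak_gradient_on S (\<lambda>x. u x t) (Du t) \<and>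
        has_L2_loc_time_derivative S Du t (dtDu t) \<and>
        weak_div_free_on S (\<lambda>x. \<sigma> x *\<^sub>R Du t x + \<epsilon> x *\<^sub>R dtDu t x))"

definition conduction_freq_eq_on ::
    "(real^2) set \<Rightarrow> (real^2 \<Rightarrow> real) \<Rightarrow> (real^2 \<Rightarrow> real) \<Rightarrow> real \<Rightarrow> (real^2 \<Rightarrow> complex) \<Rightarrow> bool" where
  "conduction_freq_eq_on S \<sigma> \<epsilon> \<omega> w \<longleftrightarrow>
     (\<exists>Dw. weak_gradient_on S w Dw \<and>
        weak_div_free_on S
          (\<lambda>x. (of_real (\<sigma> x) + \<i> * of_real \<omega> * of_real (\<epsilon> x)) *s Dw x))"


section \<open>Boundary conditions and behaviour at infinity\<close>

text \<open>
  The sign e is 1 for limits from outside S and -1 for limits from inside. The normal derivative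
  is in both cases taken in the direction of the outward normal.
\<close>

definition has_side_limit ::
    "real \<Rightarrow> (real^2) set \<Rightarrow> (real^2 \<Rightarrow> complex) \<Rightarrow> real^2 \<Rightarrow> complex \<Rightarrow> bool" where
  "has_side_limit e S w x l \<longleftrightarrow>
     ((\<lambda>s. w (x + (e * s) *\<^sub>R outward_normal S x)) \<longlongrightarrow> l) (at_right 0)"

definition has_side_normal_derivative ::
    "real \<Rightarrow> (real^2) set \<Rightarrow> (real^2 \<Rightarrow> complex) \<Rightarrow> real^2 \<Rightarrow> complex \<Rightarrow> bool" where
  "has_side_normal_derivative e S w x l \<longleftrightarrow>
     (\<forall>\<^sub>F s in at_right 0. w differentiable (at (x + (e * s) *\<^sub>R outward_normal S x))) \<and>
     ((\<lambda>s. frechet_derivative w (at (x + (e * s) *\<^sub>R outward_normal S x)) (outward_normal S x))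
        \<longlongrightarrow> l) (at_right 0)"

definition skin_conditions :: "(real^2) set \<Rightarrow> real \<Rightarrow> (real^2 \<Rightarrow> complex) \<Rightarrow> bool" where
  "skin_conditions S \<xi> w \<longleftrightarrow>
     (\<forall>x\<in>frontier S. \<exists>w_out w_in d_out.
        has_side_limit 1 S w x w_out \<and> has_side_limit (-1) S w x w_in \<and>
        has_side_normal_derivative 1 S w x d_out \<and>
        w_out - w_in = of_real \<xi> * d_out \<and>
        has_side_normal_derivative (-1) S w x 0)"

definition decays_at_infinity :: "(real^2 \<Rightarrow> complex) \<Rightarrow> bool" where
  "decays_at_infinity w \<longleftrightarrow> (\<lambda>x. norm (w x)) \<in> O[at_infinity](\<lambda>x. inverse (norm x))"


section \<open>The time-dependent system and the transmission problem\<close>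

text \<open>
  A potential is a function on the plane whose values on the boundaries of the bodies and at the
  source points (the finite set P) are irrelevant; elsewhere it is continuous.
\<close>

definition regular_points :: "(real^2) set \<Rightarrow> (real^2) set \<Rightarrow> (real^2) set \<Rightarrow> (real^2) set" where
  "regular_points \<Omega>1 \<Omega>2 P = - (frontier \<Omega>1 \<union> frontier \<Omega>2 \<union> P)"

definition exterior :: "(real^2) set \<Rightarrow> (real^2) set \<Rightarrow> (real^2) set" where
  "exterior \<Omega>1 \<Omega>2 = - closure (\<Omega>1 \<union> \<Omega>2)"

definition solves_system ::
    "(real^2) set \<Rightarrow> (real^2) set \<Rightarrow> (real^2) set \<Rightarrow> (real^2 \<Rightarrow> real) \<Rightarrow> (real^2 \<Rightarrow> real) \<Rightarrow>
     real \<Rightarrow> real \<Rightarrow> distribution \<Rightarrow> distribution \<Rightarrow> (real \<Rightarrow> complex) \<Rightarrow> (real \<Rightarrow> complex) \<Rightarrow>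
     (real^2 \<Rightarrow> real \<Rightarrow> complex) \<Rightarrow> bool" where
  "solves_system \<Omega>1 \<Omega>2 P \<sigma> \<epsilon> \<xi>1 \<xi>2 f1 f2 h1 h2 u \<longleftrightarrow>
     (\<forall>t>0. continuous_on (regular_points \<Omega>1 \<Omega>2 P) (\<lambda>x. u x t)) \<and>
     (\<forall>t>0. laplace_eq_on \<Omega>1 (\<lambda>x. u x t) (\<lambda>\<phi>. f1 \<phi> * h1 t)) \<and>
     (\<forall>t>0. laplace_eq_on \<Omega>2 (\<lambda>x. u x t) (\<lambda>\<phi>. f2 \<phi> * h2 t)) \<and>
     conduction_time_eq_on (exterior \<Omega>1 \<Omega>2) \<sigma> \<epsilon> u \<and>
     (\<forall>t>0. skin_conditions \<Omega>1 \<xi>1 (\<lambda>x. u x t)) \<and>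
     (\<forall>t>0. skin_conditions \<Omega>2 \<xi>2 (\<lambda>x. u x t)) \<and>
     (\<forall>t>0. decays_at_infinity (\<lambda>x. u x t))"

definition solves_transmission_problem ::
    "(real^2) set \<Rightarrow> (real^2) set \<Rightarrow> (real^2) set \<Rightarrow> (real^2 \<Rightarrow> real) \<Rightarrow> (real^2 \<Rightarrow> real) \<Rightarrow>
     real \<Rightarrow> real \<Rightarrow> distribution \<Rightarrow> distribution \<Rightarrow> real \<Rightarrow> (real^2 \<Rightarrow> complex) \<Rightarrow> bool" where
  "solves_transmission_problem \<Omega>1 \<Omega>2 P \<sigma> \<epsilon> \<xi>1 \<xi>2 g1 g2 \<omega> w \<longleftrightarrow>
     continuous_on (regular_points \<Omega>1 \<Omega>2 P) w \<and>
     laplace_eq_on \<Omega>1 w g1 \<and>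
     laplace_eq_on \<Omega>2 w g2 \<and>
     conduction_freq_eq_on (exterior \<Omega>1 \<Omega>2) \<sigma> \<epsilon> \<omega> w \<and>
     skin_conditions \<Omega>1 \<xi>1 w \<and>
     skin_conditions \<Omega>2 \<xi>2 w \<and>
     decays_at_infinity w"

text \<open>
  The system has no initial condition, so it has a unique solution only within a class of
  admissible evolutions. For a system that is linear and autonomous up to its forcing, such a
  class is a complex vector space that is invariant under forward time shifts.
\<close>

definition admissible_class :: "(real^2 \<Rightarrow> real \<Rightarrow> complex) set \<Rightarrow> bool" where
  "admissible_class \<U> \<longleftrightarrow>
     (\<forall>v\<in>\<U>. \<forall>w\<in>\<U>. \<forall>a b. (\<lambda>x t. a * v x t + b * w x t) \<in> \<U>) \<and>
     (\<forall>v\<in>\<U>. \<forall>s\<ge>0. (\<lambda>x t. v x (t + s)) \<in> \<U>)"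

end

theory Submission
  imports Defs "HOL-Computational_Algebra.Polynomial"
begin

text \<open>
  The system is autonomous apart from its forcing, so a delayed copy of \<open>u\<close> solves the same system
  with each source multiplied by a phase: by \<open>z1 = exp (\<i> * \<omega>1 * s)\<close> for the first source and by
  \<open>z2 = exp (\<i> * \<omega>2 * s)\<close> for the second, where \<open>s\<close> is the delay. As \<open>\<omega>1 \<noteq> \<omega>2\<close>, some delay makes
  \<open>z1 \<noteq> z2\<close>, and then two linear combinations of \<open>u\<close> and its delayed copy separate the sources:
  \<open>u = v1 + v2\<close>, where \<open>v1\<close> is driven by the first source alone and \<open>v2\<close> by the second alone
  (\<open>split_frequencies\<close>). Both stay in the admissible class.
  
  For every \<open>r \<ge> 0\<close> the difference \<open>v1 (t + r) - exp (\<i> * \<omega>1 * r) * v1 t\<close> is an admissible solution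
  of the system without sources. Adding it to \<open>u\<close> gives another solution of the original system, so
  uniqueness forces it to vanish. Hence \<open>v1\<close> is a function of the point times \<open>exp (\<i> * \<omega>1 * t)\<close>
  (\<open>single_frequency_solution_exponential\<close>), and likewise \<open>v2\<close>.
  
  It remains to see that the spatial factor of such a solution solves a transmission problem
  (\<open>solves_transmission_problem_of_exponential\<close>). All conditions except the conduction equation
  involve one time only and are linear. In the conduction equation the time derivative of the weak
  gradient must be replaced by \<open>\<i> * \<omega>\<close> times the gradient. The potential is known to oscillate
  pointwise, but the gradients at different times are given separately, each up to a null set; they
  oscillate as well because weak gradients are unique almost everywhere. That uniqueness is the
  fundamental lemma of the calculus of variations, proved with test functions that converge boundedly
  to indicator functions of boxes.
\<close>

section \<open>Smooth bump functions on boxes\<close>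

lemma poly_div_exp_tendsto_0:
  fixes p :: "real poly"
  shows "((\<lambda>y. poly p y / exp y) \<longlongrightarrow> 0) at_top"
proof -
  have "((\<lambda>y. \<Sum>i\<le>degree p. coeff p i * (y ^ i / exp y)) \<longlongrightarrow> (\<Sum>i\<le>degree p. coeff p i * 0)) at_top"
    by (intro tendsto_sum tendsto_mult tendsto_const tendsto_power_div_exp_0)
  then show ?thesis
    by (simp add: poly_altdef sum_divide_distrib)
qed

text \<open>
  The derivatives of \<open>exp (- (1 / s))\<close> on the positive half-line are polynomials in \<open>1 / s\<close> times the
  function itself. The family over all polynomials \<open>p\<close> is therefore closed under differentiation,
  which turns smoothness into an induction; \<open>p = 1\<close> is the classical flat function.
\<close>

definition flat_poly :: "real poly \<Rightarrow> real \<Rightarrow> real" where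
  "flat_poly p s = (if s > 0 then poly p (1 / s) * exp (- (1 / s)) else 0)"

text \<open>
  Every function of the family has derivative zero at the origin, because with \<open>y = 1 / s\<close> the
  exponential beats every polynomial.
\<close>

lemma flat_poly_tendsto_0: "((\<lambda>s. flat_poly p s / s) \<longlongrightarrow> 0) (at 0)"
proof -
  have "((\<lambda>s. poly (pCons 0 p) (inverse s) / exp (inverse s)) \<longlongrightarrow> 0) (at_right 0)"
    using poly_div_exp_tendsto_0 filterlim_inverse_at_top_right by (rule filterlim_compose)
  then have "((\<lambda>s. flat_poly p s / s) \<longlongrightarrow> 0) (at_right 0)"
    by (rule tendsto_cong[THEN iffD1, rotated])
      (auto simp: flat_poly_def eventually_at_filter exp_minus field_simps intro!: always_eventually)
  moreover have "((\<lambda>s. flat_poly p s / s) \<longlongrightarrow> 0) (at_left 0)"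
    by (rule tendsto_cong[THEN iffD1, OF _ tendsto_const])
      (auto simp: flat_poly_def eventually_at_filter)
  ultimately show ?thesis
    by (simp add: filterlim_split_at)
qed

lemma DERIV_flat_poly:
  "(flat_poly p has_real_derivative flat_poly ([:0, 0, 1:] * (p - pderiv p)) s) (at s)"
proof -
  consider "s > 0" | "s = 0" | "s < 0" by linarith
  then show ?thesis
  proof cases
    case 1
    have "((\<lambda>s. poly p (1 / s) * exp (- (1 / s))) has_real_derivative
        flat_poly ([:0, 0, 1:] * (p - pderiv p)) s) (at s)"
      using 1
      by (auto intro!: derivative_eq_intros DERIV_chain2[where f = "poly p"] poly_DERIV
          simp: flat_poly_def field_simps power2_eq_square)
    moreover have "\<forall>\<^sub>F y in nhds s. flat_poly p y = poly p (1 / y) * exp (- (1 / y))"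
      using eventually_nhds_in_open[of "{0<..}" s] 1
      by (auto elim!: eventually_mono simp: flat_poly_def)
    ultimately show ?thesis
      by (simp add: DERIV_cong_ev)
  next
    case 2
    then show ?thesis
      using flat_poly_tendsto_0[of p] by (simp add: DERIV_def flat_poly_def)
  next
    case 3
    moreover have "\<forall>\<^sub>F y in nhds s. flat_poly p y = 0"
      using eventually_nhds_in_open[of "{..<0}" s] 3
      by (auto elim!: eventually_mono simp: flat_poly_def)
    ultimately show ?thesis
      by (simp add: DERIV_cong_ev flat_poly_def)
  qed
qed

lemma Ck_imp_continuous_on: "Ck n \<phi> \<Longrightarrow> continuous_on UNIV \<phi>"
  by (cases n) (auto intro!: differentiable_imp_continuous_on simp: differentiable_on_def
      intro: differentiable_at_withinI)

lemma Ck_Suc_imp_Ck: "Ck (Suc n) \<phi> \<Longrightarrow> Ck n \<phi>"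
  by (induction n arbitrary: \<phi>) (use Ck_imp_continuous_on[of "Suc 0"] in auto)

lemma partial_add:
  assumes "f differentiable at x" "g differentiable at x"
  shows "partial j (\<lambda>x. f x + g x) x = partial j f x + partial j g x"
proof -
  have "((\<lambda>x. f x + g x) has_derivative
      (\<lambda>v. frechet_derivative f (at x) v + frechet_derivative g (at x) v)) (at x)"
    using assms by (intro has_derivative_add) (simp_all add: frechet_derivative_works[THEN iffD1])
  from frechet_derivative_at[OF this, symmetric] show ?thesis
    by (simp add: partial_def)
qed

lemma partial_mult:
  assumes "f differentiable at x" "g differentiable at x"
  shows "partial j (\<lambda>x. f x * g x) x = f x * partial j g x + partial j f x * g x"
proof -
  have "((\<lambda>x. f x * g x) has_derivative
      (\<lambda>v. f x * frechet_derivative g (at x) v + frechet_derivative f (at x) v * g x)) (at x)"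
    using assms by (intro has_derivative_mult) (simp_all add: frechet_derivative_works[THEN iffD1])
  from frechet_derivative_at[OF this, symmetric] show ?thesis
    by (simp add: partial_def)
qed

lemma Ck_add: "Ck n f \<Longrightarrow> Ck n g \<Longrightarrow> Ck n (\<lambda>x. f x + g x)"
proof (induction n arbitrary: f g)
  case 0
  then show ?case by (auto intro: continuous_on_add)
next
  case (Suc n)
  moreover from this have "partial j (\<lambda>x. f x + g x) = (\<lambda>x. partial j f x + partial j g x)" for j
    by (auto simp: partial_add)
  ultimately show ?case by (auto intro: differentiable_add)
qed

lemma Ck_mult: "Ck n f \<Longrightarrow> Ck n g \<Longrightarrow> Ck n (\<lambda>x. f x * g x)"
proof (induction n arbitrary: f g)
  case 0
  then show ?case by (auto intro: continuous_on_mult)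
next
  case (Suc n)
  then have "Ck n f" "Ck n g"
    by (blast intro: Ck_Suc_imp_Ck)+
  moreover from Suc have
    "partial j (\<lambda>x. f x * g x) = (\<lambda>x. f x * partial j g x + partial j f x * g x)" for j
    by (auto simp: partial_mult)
  ultimately show ?case
    using Suc by (auto intro!: differentiable_mult Ck_add)
qed

text \<open>
  A partial derivative only changes the constant factor and the polynomial, so the induction on the
  order of differentiability goes through once both are arbitrary.
\<close>

lemma Ck_flat_poly_affine: "Ck n (\<lambda>x. a * flat_poly p (c + x \<bullet> v))"
proof -
  define p' where "p' p = [:0, 0, 1:] * (p - pderiv p)" for p :: "real poly"
  have D: "((\<lambda>x. a * flat_poly p (c + x \<bullet> v)) has_derivative
      (\<lambda>h. a * (flat_poly (p' p) (c + x \<bullet> v) * (h \<bullet> v)))) (at x)" for a p x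
    unfolding p'_def
    by (rule has_derivative_mult_right)
      (rule has_derivative_compose[OF _ DERIV_flat_poly[unfolded has_field_derivative_def]],
       auto intro!: derivative_eq_intros)
  have P: "partial j (\<lambda>x. a * flat_poly p (c + x \<bullet> v)) =
      (\<lambda>x. (a * v $ j) * flat_poly (p' p) (c + x \<bullet> v))" for a p j
    by (rule ext) (simp add: partial_def frechet_derivative_at[OF D, symmetric] inner_axis' ac_simps)
  show ?thesis
  proof (induction n arbitrary: a p)
    case 0
    show ?case
      by (auto intro!: continuous_at_imp_continuous_on has_derivative_continuous[OF D])
  next
    case (Suc n)
    then show ?case
      by (auto simp: P differentiable_def intro: D)
  qed
qed

text \<open>
  As \<open>k\<close> grows, the factors \<open>exp (- 1 / ((k + 1) * s))\<close> increase to 1 for \<open>s > 0\<close> and vanish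
  otherwise. Rescaling the argument of the flat function thus yields smooth functions that are
  supported in a fixed box and tend to its indicator function.
\<close>

definition box_bump :: "real^2 \<Rightarrow> real^2 \<Rightarrow> nat \<Rightarrow> real^2 \<Rightarrow> real" where
  "box_bump a b k x =
     (\<Prod>j\<in>UNIV. flat_poly 1 (real (Suc k) * (x $ j - a $ j)) * flat_poly 1 (real (Suc k) * (b $ j - x $ j)))"

lemma box_bump_nonzero_iff: "box_bump a b k x \<noteq> 0 \<longleftrightarrow> x \<in> box a b"
  by (auto simp: box_bump_def flat_poly_def mem_box_cart zero_less_mult_iff UNIV_2 forall_2)

lemma box_bump_in_test_functions:
  assumes "cbox a b \<subseteq> S"
  shows "box_bump a b k \<in> test_functions S"
proof -
  have eq: "box_bump a b k =
     (\<lambda>x. ((1 * flat_poly 1 (- (real (Suc k) * a $ 1) + x \<bullet> axis 1 (real (Suc k)))) *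
           (1 * flat_poly 1 (real (Suc k) * b $ 1 + x \<bullet> axis 1 (- real (Suc k))))) *
          ((1 * flat_poly 1 (- (real (Suc k) * a $ 2) + x \<bullet> axis 2 (real (Suc k)))) *
           (1 * flat_poly 1 (real (Suc k) * b $ 2 + x \<bullet> axis 2 (- real (Suc k))))))"
    by (rule ext) (simp add: box_bump_def inner_axis UNIV_2 algebra_simps)
  have "Ck n (box_bump a b k)" for n
    unfolding eq by (intro Ck_mult Ck_flat_poly_affine)
  moreover have "closure {x. box_bump a b k x \<noteq> 0} \<subseteq> cbox a b"
    by (rule closure_minimal) (use box_subset_cbox[of a b] in \<open>auto simp: box_bump_nonzero_iff\<close>)
  ultimately show ?thesis
    using assms unfolding test_functions_def
    by (auto intro: compact_closure[THEN iffD2] bounded_subset[OF bounded_cbox] simp: box_bump_nonzero_iff bounded_box)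
qed

lemma box_bump_le_indicator: "\<bar>box_bump a b k x\<bar> \<le> indicator (cbox a b) x"
proof (cases "x \<in> box a b")
  case True
  have "\<bar>flat_poly 1 s\<bar> \<le> 1" for s
    by (auto simp: flat_poly_def)
  then have "\<bar>box_bump a b k x\<bar> \<le> 1"
    unfolding box_bump_def abs_prod abs_mult by (intro prod_le_1) (auto intro: mult_le_one)
  then show ?thesis
    using True box_subset_cbox[of a b] by (auto simp: indicator_def)
qed (use box_bump_nonzero_iff[of a b k x] in auto)

lemma box_bump_tendsto_indicator:
  "(\<lambda>k. box_bump a b k x) \<longlonglongrightarrow> indicator (box a b) x"
proof (cases "x \<in> box a b")
  case True
  have lim: "(\<lambda>k. flat_poly 1 (real (Suc k) * s)) \<longlonglongrightarrow> 1" if "s > 0" for s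
  proof -
    have "(\<lambda>k. exp (- (inverse (real (Suc k)) * (1 / s)))) \<longlonglongrightarrow> exp (- (0 * (1 / s)))"
      by (intro tendsto_intros LIMSEQ_inverse_real_of_nat)
    then show ?thesis
      using that by (simp add: flat_poly_def zero_less_mult_iff inverse_eq_divide)
  qed
  have "(\<lambda>k. box_bump a b k x) \<longlonglongrightarrow> (\<Prod>j\<in>(UNIV :: 2 set). 1 * 1)"
    unfolding box_bump_def using True by (intro tendsto_prod tendsto_mult lim) (auto simp: mem_box_cart)
  then show ?thesis
    using True by simp
qed (use box_bump_nonzero_iff[of a b _ x] in simp)

section \<open>The fundamental lemma of the calculus of variations\<close>

text \<open>
  Dominated convergence along \<open>box_bump a b k\<close>: the dominating function is the restriction of \<open>g\<close>
  to the closed box, and the boundary of the box is a null set.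
\<close>

lemma integral_box_eq_0:
  fixes g :: "real^2 \<Rightarrow> 'b::euclidean_space"
  assumes g: "L1_loc_on S g"
    and zero: "\<And>\<phi>. \<phi> \<in> test_functions S \<Longrightarrow> set_lebesgue_integral lebesgue S (\<lambda>x. \<phi> x *\<^sub>R g x) = 0"
    and sub: "cbox a b \<subseteq> S"
  shows "integral (cbox a b) g = 0"
proof -
  let ?s = "\<lambda>k x. indicator S x *\<^sub>R (box_bump a b k x *\<^sub>R g x)"
  have g_abs: "g absolutely_integrable_on cbox a b"
    using g sub by (auto simp: L1_loc_on_def)
  then have dom: "integrable lebesgue (\<lambda>x. norm (indicator (cbox a b) x *\<^sub>R g x))"
    unfolding set_integrable_def by (rule integrable_norm)
  have s_eq: "?s k x = box_bump a b k x *\<^sub>R (indicator (cbox a b) x *\<^sub>R g x)" for k x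
    using sub box_bump_nonzero_iff[of a b k x] box_subset_cbox[of a b]
    by (cases "x \<in> box a b") (auto simp: indicator_def)
  have meas: "(\<lambda>x. indicator (cbox a b) x *\<^sub>R g x) \<in> borel_measurable lebesgue"
    using g_abs unfolding set_integrable_def by (rule borel_measurable_integrable)
  have bump_meas: "box_bump a b k \<in> borel_measurable lebesgue" for k
  proof -
    have "Ck 0 (box_bump a b k)"
      using box_bump_in_test_functions[of a b UNIV k] by (auto simp: test_functions_def)
    then show ?thesis
      by (auto intro!: measurable_completion borel_measurable_continuous_onI)
  qed
  have "(\<lambda>k. integral\<^sup>L lebesgue (?s k)) \<longlonglongrightarrow>
      integral\<^sup>L lebesgue (\<lambda>x. indicator (box a b) x *\<^sub>R g x)"
  proof (rule integral_dominated_convergence[OF _ _ dom])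
    show "(\<lambda>x. indicator (box a b) x *\<^sub>R g x) \<in> borel_measurable lebesgue"
      using g_abs[folded absolutely_integrable_on_open_interval]
      unfolding set_integrable_def by (rule borel_measurable_integrable)
    show "?s k \<in> borel_measurable lebesgue" for k
      unfolding s_eq by (intro borel_measurable_scaleR bump_meas meas)
    show "AE x in lebesgue. (\<lambda>k. ?s k x) \<longlonglongrightarrow> indicator (box a b) x *\<^sub>R g x"
    proof (rule AE_I2)
      fix x
      have "(\<lambda>k. ?s k x) \<longlonglongrightarrow> indicator (box a b) x *\<^sub>R (indicator (cbox a b) x *\<^sub>R g x)"
        unfolding s_eq by (intro tendsto_scaleR box_bump_tendsto_indicator tendsto_const)
      also have "indicator (box a b) x *\<^sub>R (indicator (cbox a b) x *\<^sub>R g x) = indicator (box a b) x *\<^sub>R g x"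
        using box_subset_cbox[of a b] by (auto simp: indicator_def)
      finally show "(\<lambda>k. ?s k x) \<longlonglongrightarrow> indicator (box a b) x *\<^sub>R g x" .
    qed
    show "AE x in lebesgue. norm (?s k x) \<le> norm (indicator (cbox a b) x *\<^sub>R g x)" for k
    proof (rule AE_I2)
      fix x
      have "\<bar>box_bump a b k x\<bar> \<le> 1"
        using box_bump_le_indicator[of a b k x] by (rule order_trans) (simp add: indicator_def)
      then show "norm (?s k x) \<le> norm (indicator (cbox a b) x *\<^sub>R g x)"
        unfolding s_eq norm_scaleR by (intro mult_left_le_one_le) auto
    qed
  qed
  moreover have "integral\<^sup>L lebesgue (?s k) = 0" for k
    using zero[OF box_bump_in_test_functions[OF sub, of k]] by (simp add: set_lebesgue_integral_def)
  ultimately have "set_lebesgue_integral lebesgue (box a b) g = 0"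
    by (simp add: set_lebesgue_integral_def LIMSEQ_const_iff)
  moreover have "set_lebesgue_integral lebesgue (box a b) g = integral (box a b) g"
    using g_abs by (intro set_lebesgue_integral_eq_integral) (simp add: absolutely_integrable_on_open_interval)
  ultimately show ?thesis
    by (simp add: integral_open_interval)
qed

lemma negligible_if_negligible_in_cboxes:
  fixes S :: "'a::euclidean_space set"
  assumes "open S" and cube: "\<And>c d. cbox c d \<subseteq> S \<Longrightarrow> negligible {x \<in> cbox c d. P x}"
  shows "negligible {x \<in> S. P x}"
proof -
  obtain \<D> where \<D>: "countable \<D>" "\<D> \<subseteq> Pow S" "\<And>X. X \<in> \<D> \<Longrightarrow> \<exists>a b. X = cbox a b" "\<Union>\<D> = S"
    using open_countable_Union_open_cbox[OF \<open>open S\<close>] by blast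
  have "{x \<in> S. P x} = (\<Union>X\<in>\<D>. {x \<in> X. P x})"
    using \<D>(4) by auto
  moreover have "negligible {x \<in> X. P x}" if "X \<in> \<D>" for X
    using \<D>(2,3) that cube by blast
  then have "negligible (\<Union>X\<in>\<D>. {x \<in> X. P x})"
    by (intro negligible_countable_Union) (use \<D>(1) in auto)
  ultimately show ?thesis
    by simp
qed

text \<open>
  Almost every value of a locally integrable function is the limit of its averages over shrinking
  cubes, and these averages vanish by the previous results.
\<close>

lemma fundamental_lemma_of_calculus_of_variations:
  fixes g :: "real^2 \<Rightarrow> 'b::euclidean_space"
  assumes "open S" and g: "L1_loc_on S g"
    and zero: "\<And>\<phi>. \<phi> \<in> test_functions S \<Longrightarrow> set_lebesgue_integral lebesgue S (\<lambda>x. \<phi> x *\<^sub>R g x) = 0"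
  shows "negligible {x \<in> S. g x \<noteq> 0}"
proof (rule negligible_if_negligible_in_cboxes[OF \<open>open S\<close>])
  show "negligible {x \<in> cbox c d. g x \<noteq> 0}" if sub: "cbox c d \<subseteq> S" for c d
  proof -
    \<comment> \<open>Cutting \<open>g\<close> off outside \<open>cbox c d\<close> gives a function that is integrable on all boxes, including
      those that leave \<open>S\<close>, where \<open>g\<close> may fail to be integrable.\<close>
    define f where "f x = (if x \<in> cbox c d then g x else 0)" for x
    have "g absolutely_integrable_on cbox c d"
      using g sub by (auto simp: L1_loc_on_def)
    then have "f absolutely_integrable_on UNIV"
      unfolding f_def by (simp add: absolutely_integrable_restrict_UNIV)
    then have "f integrable_on cbox a b" for a b
      by (meson absolutely_integrable_on_def absolutely_integrable_on_subcbox subset_UNIV)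
    then obtain N where N: "negligible N" and
      lim: "\<And>x e. \<lbrakk>x \<notin> N; 0 < e\<rbrakk> \<Longrightarrow> \<exists>\<delta>>0. \<forall>h. 0 < h \<and> h < \<delta> \<longrightarrow>
         norm (integral (cbox x (x + h *\<^sub>R One)) f /\<^sub>R h ^ DIM(real^2) - f x) < e"
      by (rule integrable_ccontinuous_explicit) blast
    have "g x = 0" if x: "x \<in> box c d" "x \<notin> N" for x
    proof (rule ccontr)
      assume "g x \<noteq> 0"
      moreover have fx: "f x = g x"
        using x box_subset_cbox[of c d] by (auto simp: f_def)
      ultimately obtain \<delta> where \<delta>: "\<delta> > 0" "\<And>h. 0 < h \<Longrightarrow> h < \<delta> \<Longrightarrow>
         norm (integral (cbox x (x + h *\<^sub>R One)) f /\<^sub>R h ^ DIM(real^2) - f x) < norm (g x)"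
        using lim[OF x(2), of "norm (g x)"] by auto
      have "((\<lambda>h. x + h *\<^sub>R One) \<longlongrightarrow> x + 0 *\<^sub>R One) (at_right (0::real))"
        by (intro tendsto_intros)
      then have "\<forall>\<^sub>F h in at_right (0::real). x + h *\<^sub>R One \<in> box c d"
        using x(1) by (intro topological_tendstoD) auto
      moreover have "\<forall>\<^sub>F h in at_right (0::real). 0 < h \<and> h < \<delta>"
        using \<delta>(1) eventually_at_right_field by blast
      ultimately have "\<forall>\<^sub>F h in at_right (0::real). x + h *\<^sub>R One \<in> box c d \<and> 0 < h \<and> h < \<delta>"
        by (rule eventually_conj)
      then obtain h where h: "x + h *\<^sub>R One \<in> box c d" "0 < h" "h < \<delta>"
        using eventually_happens trivial_limit_at_right_real by blast
      have box: "cbox x (x + h *\<^sub>R One) \<subseteq> cbox c d"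
        using x(1) h(1) by (force simp: mem_box subset_box)
      have "integral (cbox x (x + h *\<^sub>R One)) f = integral (cbox x (x + h *\<^sub>R One)) g"
        using box by (intro integral_cong) (auto simp: f_def)
      also have "\<dots> = 0"
        using integral_box_eq_0[OF g zero] box sub by blast
      finally show False
        using \<delta>(2)[OF h(2,3)] by (simp add: fx)
    qed
    then have "{x \<in> cbox c d. g x \<noteq> 0} \<subseteq> N \<union> (cbox c d - box c d)"
      by auto
    then show ?thesis
      using N negligible_Un negligible_frontier_interval negligible_subset by blast
  qed
qed

section \<open>Linearity of the weak equations\<close>

lemma partial_in_test_functions:
  assumes "\<phi> \<in> test_functions S"
  shows "partial j \<phi> \<in> test_functions S"
proof -
  have zero: "partial j \<phi> x = 0" if "x \<notin> closure {x. \<phi> x \<noteq> 0}" for x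
  proof -
    have "((\<lambda>_. 0) has_derivative (\<lambda>_. 0)) (at x)"
      by (rule has_derivative_const)
    then have "(\<phi> has_derivative (\<lambda>_. 0)) (at x)"
      by (rule has_derivative_transform_within_open[of _ _ _ _ "- closure {x. \<phi> x \<noteq> 0}"])
        (use that closure_subset[of "{x. \<phi> x \<noteq> 0}"] in auto)
    from frechet_derivative_at[OF this, symmetric] show ?thesis
      by (simp add: partial_def)
  qed
  have "closure {x. partial j \<phi> x \<noteq> 0} \<subseteq> closure {x. \<phi> x \<noteq> 0}"
    by (rule closure_minimal) (use zero in blast)+
  moreover have "Ck n (partial j \<phi>)" for n
    using assms by (auto simp: test_functions_def dest: spec[of _ "Suc n"])
  ultimately show ?thesis
    using assms unfolding test_functions_def
    by (auto simp: compact_eq_bounded_closed intro: bounded_subset)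
qed

text \<open>
  All integrals in the weak formulations have this form; their additivity rests on this integrability,
  since the Bochner integral of a non-integrable function is zero by convention.
\<close>

lemma set_integrable_test_function:
  fixes g :: "real^2 \<Rightarrow> 'b::euclidean_space"
  assumes \<phi>: "\<phi> \<in> test_functions S" and g: "L1_loc_on S g"
  shows "set_integrable lebesgue S (\<lambda>x. \<phi> x *\<^sub>R g x)"
proof -
  define K where "K = closure {x. \<phi> x \<noteq> 0}"
  have K: "compact K" "K \<subseteq> S"
    using \<phi> by (auto simp: test_functions_def K_def)
  have off_K: "\<phi> x = 0" if "x \<notin> K" for x
    using that closure_subset[of "{x. \<phi> x \<noteq> 0}"] by (auto simp: K_def)
  have "Ck 0 \<phi>"
    using \<phi> by (auto simp: test_functions_def)
  then have cont: "continuous_on K \<phi>"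
    by (auto intro: continuous_on_subset)
  have "(\<lambda>x. \<phi> x *\<^sub>R g x) absolutely_integrable_on K"
  proof (rule absolutely_integrable_bounded_measurable_product[of "(*\<^sub>R)"])
    show "bilinear ((*\<^sub>R) :: real \<Rightarrow> 'b \<Rightarrow> 'b)"
      by (rule bounded_bilinear_scaleR[THEN bilinear_conv_bounded_bilinear[THEN iffD2]])
    show meas: "K \<in> sets lebesgue"
      using K(1) by (intro fmeasurableD lmeasurable_compact)
    show "\<phi> \<in> borel_measurable (lebesgue_on K)"
      using cont meas by (rule continuous_imp_measurable_on_sets_lebesgue)
    show "bounded (\<phi> ` K)"
      using compact_continuous_image[OF cont K(1)] by (rule compact_imp_bounded)
    show "g absolutely_integrable_on K"
      using g K by (auto simp: L1_loc_on_def)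
  qed
  moreover have "(\<lambda>x. indicator K x *\<^sub>R (\<phi> x *\<^sub>R g x)) = (\<lambda>x. indicator S x *\<^sub>R (\<phi> x *\<^sub>R g x))"
    using off_K K(2) by (auto simp: indicator_def fun_eq_iff)
  ultimately show ?thesis
    by (simp add: set_integrable_def)
qed

lemma L1_loc_on_add: "L1_loc_on S f \<Longrightarrow> L1_loc_on S g \<Longrightarrow> L1_loc_on S (\<lambda>x. f x + g x)"
  by (simp add: L1_loc_on_def)

lemma L1_loc_on_linear: "L1_loc_on S f \<Longrightarrow> bounded_linear h \<Longrightarrow> L1_loc_on S (\<lambda>x. h (f x))"
  using absolutely_integrable_linear[where f=f and h=h] by (auto simp: L1_loc_on_def o_def)

lemma bounded_linear_vector_scalar_mult: "bounded_linear (\<lambda>v. (a :: complex) *s (v :: complex^2))"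
  by (auto simp: linear_conv_bounded_linear[symmetric] vec_eq_iff algebra_simps intro!: linearI)

lemma norm_vector_scalar_mult: "norm ((a :: complex) *s (v :: complex^2)) = norm a * norm v"
  by (simp add: norm_vec_def norm_mult L2_set_right_distrib)

lemma L1_loc_on_combination:
  "L1_loc_on S f \<Longrightarrow> L1_loc_on S g \<Longrightarrow> L1_loc_on S (\<lambda>x. a * f x + b * (g x :: complex))"
  by (intro L1_loc_on_add L1_loc_on_linear[OF _ bounded_linear_mult_right])

lemma L1_loc_on_vec_combination:
  "L1_loc_on S f \<Longrightarrow> L1_loc_on S g \<Longrightarrow> L1_loc_on S (\<lambda>x. a *s f x + b *s (g x :: complex^2))"
  by (intro L1_loc_on_add L1_loc_on_linear[OF _ bounded_linear_vector_scalar_mult])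

lemma L1_loc_on_nth: "L1_loc_on S f \<Longrightarrow> L1_loc_on S (\<lambda>x. (f x :: complex^2) $ j)"
  by (rule L1_loc_on_linear[OF _ bounded_linear_vec_nth])

text \<open>
  Domination suffices because local integrability of \<open>f\<close> already provides measurability.
\<close>

lemma L2_loc_onI:
  assumes f: "L1_loc_on S f" and G: "L1_loc_on S G" and le: "\<And>x. (norm (f x))\<^sup>2 \<le> G x"
  shows "L2_loc_on S f"
proof -
  have "L1_loc_on S (\<lambda>x. (norm (f x))\<^sup>2)"
    unfolding L1_loc_on_def
  proof (intro allI impI)
    fix K assume K: "compact K" "K \<subseteq> S"
    have meas: "K \<in> sets lebesgue"
      using K(1) by (intro fmeasurableD lmeasurable_compact)
    have f_int: "f absolutely_integrable_on K" and G_int: "G absolutely_integrable_on K"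
      using f G K by (auto simp: L1_loc_on_def)
    have [measurable]: "f \<in> borel_measurable (lebesgue_on K)"
      using f_int meas by (rule absolutely_integrable_imp_borel_measurable)
    have "(\<lambda>x. (norm (f x))\<^sup>2) \<in> borel_measurable (lebesgue_on K)"
      by measurable
    then show "(\<lambda>x. (norm (f x))\<^sup>2) absolutely_integrable_on K"
      by (rule measurable_bounded_by_integrable_imp_absolutely_integrable
          [OF _ meas set_lebesgue_integral_eq_integral(1)[OF G_int]]) (simp add: le)
  qed
  with f show ?thesis
    by (simp add: L2_loc_on_def)
qed

lemma norm_sum_squared_le:
  fixes x y :: "'a::real_normed_vector"
  shows "(norm (x + y))\<^sup>2 \<le> 2 * (norm x)\<^sup>2 + 2 * (norm y)\<^sup>2"
proof -
  have "(norm (x + y))\<^sup>2 \<le> (norm x + norm y)\<^sup>2"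
    by (intro power_mono norm_triangle_ineq) auto
  also have "\<dots> \<le> 2 * (norm x)\<^sup>2 + 2 * (norm y)\<^sup>2"
    using sum_squares_bound[of "norm x" "norm y"] by (simp add: power2_sum)
  finally show ?thesis .
qed

lemma L2_loc_on_add:
  assumes "L2_loc_on S f" "L2_loc_on S g"
  shows "L2_loc_on S (\<lambda>x. f x + g x)"
proof (rule L2_loc_onI)
  show "L1_loc_on S (\<lambda>x. 2 * (norm (f x))\<^sup>2 + 2 * (norm (g x))\<^sup>2)"
    using assms unfolding L2_loc_on_def
    by (intro L1_loc_on_add L1_loc_on_linear[OF _ bounded_linear_mult_right]) auto
  show "L1_loc_on S (\<lambda>x. f x + g x)"
    using assms unfolding L2_loc_on_def by (intro L1_loc_on_add) auto
qed (rule norm_sum_squared_le)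

lemma L2_loc_on_scale:
  fixes f :: "real^2 \<Rightarrow> complex^2"
  assumes "L2_loc_on S f"
  shows "L2_loc_on S (\<lambda>x. a *s f x)"
  using assms unfolding L2_loc_on_def norm_vector_scalar_mult power_mult_distrib
  by (intro conjI L1_loc_on_linear[OF _ bounded_linear_mult_right]
      L1_loc_on_linear[OF _ bounded_linear_vector_scalar_mult]) simp_all

lemma L2_loc_on_vec_combination:
  fixes f g :: "real^2 \<Rightarrow> complex^2"
  shows "L2_loc_on S f \<Longrightarrow> L2_loc_on S g \<Longrightarrow> L2_loc_on S (\<lambda>x. a *s f x + b *s g x)"
  by (intro L2_loc_on_add L2_loc_on_scale)

lemma L2_loc_on_combination:
  assumes "L2_loc_on S f" "L2_loc_on S g"
  shows "L2_loc_on S (\<lambda>x. a * f x + b * (g x :: complex))"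
proof -
  have "L2_loc_on S (\<lambda>x. a * f x)" if "L2_loc_on S f" for a and f :: "real^2 \<Rightarrow> complex"
    using that unfolding L2_loc_on_def norm_mult power_mult_distrib
    by (intro conjI L1_loc_on_linear[OF _ bounded_linear_mult_right]) simp_all
  with assms show ?thesis
    by (intro L2_loc_on_add)
qed

lemma set_integral_combination:
  fixes f g :: "'a \<Rightarrow> complex"
  assumes "set_integrable M S f" "set_integrable M S g"
  shows "set_lebesgue_integral M S (\<lambda>x. a * f x + b * g x) =
    a * set_lebesgue_integral M S f + b * set_lebesgue_integral M S g"
  using assms by (subst set_integral_add(2)) auto

lemma laplace_eq_on_combination:
  assumes "laplace_eq_on S v F" "laplace_eq_on S w G"
  shows "laplace_eq_on S (\<lambda>x. a * v x + b * w x) (\<lambda>\<phi>. a * F \<phi> + b * G \<phi>)"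
proof -
  have int: "set_integrable lebesgue S (\<lambda>x. laplacian \<phi> x *\<^sub>R w x)"
    if "\<phi> \<in> test_functions S" "L1_loc_on S w" for \<phi> and w :: "real^2 \<Rightarrow> complex"
    unfolding laplacian_def scaleR_sum_left
    by (intro absolutely_integrable_sum set_integrable_test_function partial_in_test_functions that) simp
  have "set_lebesgue_integral lebesgue S (\<lambda>x. laplacian \<phi> x *\<^sub>R (a * v x + b * w x)) =
      a * F \<phi> + b * G \<phi>" if "\<phi> \<in> test_functions S" for \<phi>
  proof -
    have "set_lebesgue_integral lebesgue S (\<lambda>x. laplacian \<phi> x *\<^sub>R (a * v x + b * w x)) =
      set_lebesgue_integral lebesgue S (\<lambda>x. a * (laplacian \<phi> x *\<^sub>R v x) + b * (laplacian \<phi> x *\<^sub>R w x))"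
      by (simp add: scaleR_add_right)
    also have "\<dots> = a * F \<phi> + b * G \<phi>"
      using assms that by (subst set_integral_combination) (auto simp: laplace_eq_on_def intro!: int)
    finally show ?thesis .
  qed
  then show ?thesis
    using assms by (auto simp: laplace_eq_on_def intro: L1_loc_on_combination)
qed

lemma weak_gradient_on_combination:
  assumes "weak_gradient_on S v Dv" "weak_gradient_on S w Dw"
  shows "weak_gradient_on S (\<lambda>x. a * v x + b * w x) (\<lambda>x. a *s Dv x + b *s Dw x)"
proof -
  have "set_lebesgue_integral lebesgue S (\<lambda>x. partial j \<phi> x *\<^sub>R (a * v x + b * w x)) =
      - set_lebesgue_integral lebesgue S (\<lambda>x. \<phi> x *\<^sub>R ((a *s Dv x + b *s Dw x) $ j))"
    if \<phi>: "\<phi> \<in> test_functions S" for \<phi> j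
  proof -
    have "set_lebesgue_integral lebesgue S (\<lambda>x. partial j \<phi> x *\<^sub>R (a * v x + b * w x)) =
        set_lebesgue_integral lebesgue S
          (\<lambda>x. a * (partial j \<phi> x *\<^sub>R v x) + b * (partial j \<phi> x *\<^sub>R w x))"
      by (simp add: scaleR_add_right)
    also have "\<dots> = a * set_lebesgue_integral lebesgue S (\<lambda>x. partial j \<phi> x *\<^sub>R v x) +
        b * set_lebesgue_integral lebesgue S (\<lambda>x. partial j \<phi> x *\<^sub>R w x)"
      using assms by (intro set_integral_combination set_integrable_test_function
          partial_in_test_functions \<phi>) (auto simp: weak_gradient_on_def L2_loc_on_def)
    also have "\<dots> = - (a * set_lebesgue_integral lebesgue S (\<lambda>x. \<phi> x *\<^sub>R (Dv x $ j)) +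
        b * set_lebesgue_integral lebesgue S (\<lambda>x. \<phi> x *\<^sub>R (Dw x $ j)))"
      using assms \<phi> by (simp add: weak_gradient_on_def)
    also have "a * set_lebesgue_integral lebesgue S (\<lambda>x. \<phi> x *\<^sub>R (Dv x $ j)) +
        b * set_lebesgue_integral lebesgue S (\<lambda>x. \<phi> x *\<^sub>R (Dw x $ j)) =
        set_lebesgue_integral lebesgue S
          (\<lambda>x. a * (\<phi> x *\<^sub>R (Dv x $ j)) + b * (\<phi> x *\<^sub>R (Dw x $ j)))"
      using assms by (intro set_integral_combination[symmetric] set_integrable_test_function
          L1_loc_on_nth \<phi>) (auto simp: weak_gradient_on_def L2_loc_on_def)
    finally show ?thesis
      by (simp add: scaleR_add_right)
  qed
  then show ?thesis
    using assms
    by (auto simp: weak_gradient_on_def intro: L2_loc_on_combination L2_loc_on_vec_combination)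
qed

text \<open>
  The difference of the two fields is a weak gradient of a function that vanishes on \<open>S\<close>, so each of
  its components annihilates all test functions.
\<close>

lemma weak_gradient_on_unique:
  assumes "open S" "weak_gradient_on S v Dv" "weak_gradient_on S w Dw" "\<And>x. x \<in> S \<Longrightarrow> v x = w x"
  shows "negligible {x \<in> S. Dv x \<noteq> Dw x}"
proof -
  define D where "D x = 1 *s Dv x + (-1) *s Dw x" for x
  have D: "weak_gradient_on S (\<lambda>x. 1 * v x + (-1) * w x) D"
    unfolding D_def by (rule weak_gradient_on_combination[OF assms(2,3)])
  have "negligible {x \<in> S. D x $ j \<noteq> 0}" for j
  proof (rule fundamental_lemma_of_calculus_of_variations[OF \<open>open S\<close>])
    show "L1_loc_on S (\<lambda>x. D x $ j)"
      using D by (auto simp: weak_gradient_on_def L2_loc_on_def intro: L1_loc_on_nth)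
    fix \<phi> assume "\<phi> \<in> test_functions S"
    then have "set_lebesgue_integral lebesgue S (\<lambda>x. \<phi> x *\<^sub>R (D x $ j)) =
        - set_lebesgue_integral lebesgue S (\<lambda>x. partial j \<phi> x *\<^sub>R (1 * v x + (-1) * w x))"
      using D by (simp add: weak_gradient_on_def)
    also have "set_lebesgue_integral lebesgue S (\<lambda>x. partial j \<phi> x *\<^sub>R (1 * v x + (-1) * w x)) =
        set_lebesgue_integral lebesgue S (\<lambda>x. 0)"
      using assms(1,4) by (intro set_lebesgue_integral_cong) auto
    finally show "set_lebesgue_integral lebesgue S (\<lambda>x. \<phi> x *\<^sub>R (D x $ j)) = 0"
      by simp
  qed
  then have "negligible (\<Union>j\<in>UNIV. {x \<in> S. D x $ j \<noteq> 0})"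
    by (intro negligible_Union) auto
  moreover have "{x \<in> S. Dv x \<noteq> Dw x} = (\<Union>j\<in>UNIV. {x \<in> S. D x $ j \<noteq> 0})"
    by (auto simp: D_def vec_eq_iff)
  ultimately show ?thesis
    by simp
qed

lemma weak_div_free_on_combination:
  assumes "weak_div_free_on S F" "weak_div_free_on S G"
  shows "weak_div_free_on S (\<lambda>x. a *s F x + b *s G x)"
proof -
  have "set_lebesgue_integral lebesgue S
      (\<lambda>x. \<Sum>j\<in>UNIV. partial j \<phi> x *\<^sub>R ((a *s F x + b *s G x) $ j)) = 0"
    if \<phi>: "\<phi> \<in> test_functions S" for \<phi>
  proof -
    have "set_lebesgue_integral lebesgue S
          (\<lambda>x. \<Sum>j\<in>UNIV. partial j \<phi> x *\<^sub>R ((a *s F x + b *s G x) $ j)) =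
        set_lebesgue_integral lebesgue S (\<lambda>x. a * (\<Sum>j\<in>UNIV. partial j \<phi> x *\<^sub>R (F x $ j)) +
          b * (\<Sum>j\<in>UNIV. partial j \<phi> x *\<^sub>R (G x $ j)))"
      by (simp add: scaleR_add_right sum.distrib sum_distrib_left)
    also have "\<dots> = a * 0 + b * 0"
      using assms \<phi>
      by (subst set_integral_combination)
        (auto simp: weak_div_free_on_def intro!: absolutely_integrable_sum
          set_integrable_test_function partial_in_test_functions L1_loc_on_nth)
    finally show ?thesis
      by simp
  qed
  then show ?thesis
    using assms by (auto simp: weak_div_free_on_def intro: L1_loc_on_vec_combination)
qed

text \<open>
  Weak gradients and their time derivatives are determined only almost everywhere, so equations between
  them have to be transported along null sets.
\<close>

lemma weak_div_free_on_spike: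
  assumes F: "weak_div_free_on S F" and neg: "negligible {x \<in> S. F x \<noteq> G x}"
  shows "weak_div_free_on S G"
proof -
  have G: "L1_loc_on S G"
    unfolding L1_loc_on_def
  proof (intro allI impI)
    fix K assume "compact K" "K \<subseteq> S"
    with F have "F absolutely_integrable_on K"
      by (auto simp: weak_div_free_on_def L1_loc_on_def)
    then show "G absolutely_integrable_on K"
      by (rule absolutely_integrable_spike[OF _ neg]) (use \<open>K \<subseteq> S\<close> in auto)
  qed
  have "set_lebesgue_integral lebesgue S (\<lambda>x. \<Sum>j\<in>UNIV. partial j \<phi> x *\<^sub>R (G x $ j)) = 0"
    if \<phi>: "\<phi> \<in> test_functions S" for \<phi>
  proof -
    have int: "(\<lambda>x. \<Sum>j\<in>UNIV. partial j \<phi> x *\<^sub>R (H x $ j)) absolutely_integrable_on S"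
      if "L1_loc_on S H" for H :: "real^2 \<Rightarrow> complex^2"
      by (intro absolutely_integrable_sum set_integrable_test_function partial_in_test_functions
          L1_loc_on_nth \<phi> that) simp
    have "integral S (\<lambda>x. \<Sum>j\<in>UNIV. partial j \<phi> x *\<^sub>R (G x $ j)) =
        integral S (\<lambda>x. \<Sum>j\<in>UNIV. partial j \<phi> x *\<^sub>R (F x $ j))"
      by (rule integral_spike[OF neg]) auto
    then show ?thesis
      using F \<phi> set_lebesgue_integral_eq_integral(2)[OF int[of F]]
        set_lebesgue_integral_eq_integral(2)[OF int[OF G]]
      by (simp add: weak_div_free_on_def)
  qed
  with G show ?thesis
    by (simp add: weak_div_free_on_def)
qed

text \<open>
  A substitute for the triangle inequality in L2 that avoids square roots; the constant 2 is harmless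
  because it is only applied to quantities that tend to zero.
\<close>

lemma set_integral_norm_squared_combination_le:
  fixes f g :: "real^2 \<Rightarrow> complex^2"
  assumes "L2_loc_on S f" "L2_loc_on S g" "compact K" "K \<subseteq> S"
  shows "set_lebesgue_integral lebesgue K (\<lambda>x. (norm (a *s f x + b *s g x))\<^sup>2) \<le>
     2 * (norm a)\<^sup>2 * set_lebesgue_integral lebesgue K (\<lambda>x. (norm (f x))\<^sup>2) +
     2 * (norm b)\<^sup>2 * set_lebesgue_integral lebesgue K (\<lambda>x. (norm (g x))\<^sup>2)"
proof -
  have int: "(\<lambda>x. (norm (f x))\<^sup>2) absolutely_integrable_on K" if "L2_loc_on S f" for f :: "real^2 \<Rightarrow> complex^2"
    using that assms(3,4) by (auto simp: L2_loc_on_def L1_loc_on_def)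
  have "set_lebesgue_integral lebesgue K (\<lambda>x. (norm (a *s f x + b *s g x))\<^sup>2) \<le>
      set_lebesgue_integral lebesgue K
        (\<lambda>x. 2 * (norm a)\<^sup>2 * (norm (f x))\<^sup>2 + 2 * (norm b)\<^sup>2 * (norm (g x))\<^sup>2)"
    using norm_sum_squared_le[of "a *s f x" "b *s g x" for x] assms(1,2)
    by (intro set_integral_mono set_integral_add int L2_loc_on_vec_combination set_integrable_mult_right)
       (auto simp: norm_vector_scalar_mult power_mult_distrib mult.assoc)
  also have "\<dots> = 2 * (norm a)\<^sup>2 * set_lebesgue_integral lebesgue K (\<lambda>x. (norm (f x))\<^sup>2) +
     2 * (norm b)\<^sup>2 * set_lebesgue_integral lebesgue K (\<lambda>x. (norm (g x))\<^sup>2)"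
    using assms(1,2) by (subst set_integral_add(2)) (auto intro!: int set_integrable_mult_right)
  finally show ?thesis .
qed

section \<open>Time derivatives in local L2\<close>

lemma scaleR_eq_vector_scalar_mult: "r *\<^sub>R (v :: complex^2) = of_real r *s v"
  unfolding vec_eq_iff vector_scaleR_component by (simp add: scaleR_conv_of_real)

lemma L2_loc_on_difference_quotient:
  assumes "\<And>s. s > 0 \<Longrightarrow> L2_loc_on S (D s)" "L2_loc_on S G" "t > 0" "t + h > 0"
  shows "L2_loc_on S (\<lambda>x. (1 / h) *\<^sub>R (D (t + h) x - D t x) - (G x :: complex^2))"
proof -
  have "L2_loc_on S (\<lambda>x. 1 *s (of_real (1 / h) *s D (t + h) x + (- of_real (1 / h)) *s D t x) + (-1) *s G x)"
    using assms by (intro L2_loc_on_vec_combination) auto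
  then show ?thesis
    by (simp add: scaleR_eq_vector_scalar_mult vector_ssub_ldistrib)
qed

lemma eventually_at_0_add_pos:
  assumes "t > 0"
  shows "\<forall>\<^sub>F h in at 0. t + h > (0 :: real)"
  using assms by (auto simp: eventually_at dist_real_def intro!: exI[of _ t])

lemma has_L2_loc_time_derivative_combination:
  assumes D: "\<And>s. s > 0 \<Longrightarrow> L2_loc_on S (D s)" and E: "\<And>s. s > 0 \<Longrightarrow> L2_loc_on S (E s)" and t: "t > 0"
    and dD: "has_L2_loc_time_derivative S D t G" and dE: "has_L2_loc_time_derivative S E t H"
  shows "has_L2_loc_time_derivative S (\<lambda>s x. a *s D s x + b *s E s x) t (\<lambda>x. a *s G x + b *s H x)"
  unfolding has_L2_loc_time_derivative_def
proof (intro conjI allI impI)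
  have GH: "L2_loc_on S G" "L2_loc_on S H"
    using dD dE by (auto simp: has_L2_loc_time_derivative_def)
  then show "L2_loc_on S (\<lambda>x. a *s G x + b *s H x)"
    by (rule L2_loc_on_vec_combination)
  fix K assume K: "compact K" "K \<subseteq> S"
  define QD where "QD h x = (1 / h) *\<^sub>R (D (t + h) x - D t x) - G x" for h x
  define QE where "QE h x = (1 / h) *\<^sub>R (E (t + h) x - E t x) - H x" for h x
  let ?I = "\<lambda>f. set_lebesgue_integral lebesgue K (\<lambda>x. (norm (f x))\<^sup>2)"
  have Q: "(1 / h) *\<^sub>R ((a *s D (t + h) x + b *s E (t + h) x) - (a *s D t x + b *s E t x)) -
      (a *s G x + b *s H x) = a *s QD h x + b *s QE h x" for h x
    by (simp add: QD_def QE_def vec_eq_iff scaleR_conv_of_real algebra_simps)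
  have "((\<lambda>h. ?I (\<lambda>x. a *s QD h x + b *s QE h x)) \<longlongrightarrow> 0) (at 0)"
  proof (rule tendsto_sandwich)
    show "\<forall>\<^sub>F h in at 0. 0 \<le> ?I (\<lambda>x. a *s QD h x + b *s QE h x)"
      by (auto simp: set_lebesgue_integral_def intro!: always_eventually integral_nonneg_AE)
    show "\<forall>\<^sub>F h in at 0. ?I (\<lambda>x. a *s QD h x + b *s QE h x) \<le>
        2 * (norm a)\<^sup>2 * ?I (QD h) + 2 * (norm b)\<^sup>2 * ?I (QE h)"
      using eventually_at_0_add_pos[OF t]
    proof (rule eventually_mono)
      fix h assume "t + h > 0"
      then show "?I (\<lambda>x. a *s QD h x + b *s QE h x) \<le>
          2 * (norm a)\<^sup>2 * ?I (QD h) + 2 * (norm b)\<^sup>2 * ?I (QE h)"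
        unfolding QD_def QE_def
        by (intro set_integral_norm_squared_combination_le[OF _ _ K]
            L2_loc_on_difference_quotient D E GH t)
    qed
    have "((\<lambda>h. ?I (QD h)) \<longlongrightarrow> 0) (at 0)" "((\<lambda>h. ?I (QE h)) \<longlongrightarrow> 0) (at 0)"
      using dD dE K by (auto simp: has_L2_loc_time_derivative_def QD_def QE_def)
    then have "((\<lambda>h. 2 * (norm a)\<^sup>2 * ?I (QD h) + 2 * (norm b)\<^sup>2 * ?I (QE h)) \<longlongrightarrow>
        2 * (norm a)\<^sup>2 * 0 + 2 * (norm b)\<^sup>2 * 0) (at 0)"
      by (intro tendsto_intros)
    then show "((\<lambda>h. 2 * (norm a)\<^sup>2 * ?I (QD h) + 2 * (norm b)\<^sup>2 * ?I (QE h)) \<longlongrightarrow> 0) (at 0)"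
      by simp
  qed (rule tendsto_const)
  then show "((\<lambda>h. ?I (\<lambda>x. (1 / h) *\<^sub>R ((a *s D (t + h) x + b *s E (t + h) x) -
      (a *s D t x + b *s E t x)) - (a *s G x + b *s H x))) \<longlongrightarrow> 0) (at 0)"
    by (simp only: Q)
qed

lemma exp_difference_quotient_tendsto:
  "((\<lambda>h. (exp (\<i> * of_real \<omega> * of_real h) - 1) / of_real h) \<longlongrightarrow> \<i> * of_real \<omega>) (at (0 :: real))"
proof -
  have "((\<lambda>z. exp (\<i> * of_real \<omega> * z)) has_field_derivative \<i> * of_real \<omega>) (at 0)"
    by (auto intro!: derivative_eq_intros)
  then have "((\<lambda>z. (exp (\<i> * of_real \<omega> * z) - 1) / z) \<longlongrightarrow> \<i> * of_real \<omega>) (at 0)"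
    by (simp add: DERIV_def)
  moreover have "filterlim (\<lambda>h :: real. of_real h :: complex) (at 0) (at 0)"
    by (intro filterlim_atI) (auto intro!: tendsto_eq_intros simp: eventually_at_filter)
  ultimately show ?thesis
    by (rule filterlim_compose)
qed

text \<open>
  The difference quotients of \<open>D\<close> at \<open>t\<close> are almost everywhere \<open>q h\<close> times \<open>D t\<close>, where the scalars \<open>q h\<close> tend
  to \<open>\<i> * \<omega>\<close>. The quotients converge both to \<open>G\<close> and to \<open>(\<i> * \<omega>) *s D t\<close> in local L2, and the limit in L2
  is unique almost everywhere.
\<close>

lemma L2_loc_time_derivative_of_exponential:
  assumes "open S" and D: "\<And>s. s > 0 \<Longrightarrow> L2_loc_on S (D s)" and t: "t > 0"
    and dD: "has_L2_loc_time_derivative S D t G"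
    and exponential: "\<And>s. s > 0 \<Longrightarrow>
      negligible {x \<in> S. D s x \<noteq> exp (\<i> * of_real \<omega> * of_real (s - t)) *s D t x}"
  shows "negligible {x \<in> S. G x \<noteq> (\<i> * of_real \<omega>) *s D t x}"
proof (rule negligible_if_negligible_in_cboxes[OF \<open>open S\<close>])
  fix c d :: "real^2" assume sub: "cbox c d \<subseteq> S"
  define K where "K = cbox c d"
  have K: "compact K" "K \<subseteq> S"
    using sub by (auto simp: K_def)
  have G: "L2_loc_on S G"
    using dD by (simp add: has_L2_loc_time_derivative_def)
  let ?I = "\<lambda>f. set_lebesgue_integral lebesgue K (\<lambda>x. (norm (f x :: complex^2))\<^sup>2)"
  define Q where "Q h x = (1 / h) *\<^sub>R (D (t + h) x - D t x) - G x" for h x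
  define q where "q h = (exp (\<i> * of_real \<omega> * of_real h) - 1) / of_real h" for h :: real
  define R where "R x = (\<i> * of_real \<omega>) *s D t x + (-1) *s G x" for x
  have int: "(\<lambda>x. (norm (f x))\<^sup>2) absolutely_integrable_on K" if "L2_loc_on S f" for f :: "real^2 \<Rightarrow> complex^2"
    using that K by (auto simp: L2_loc_on_def L1_loc_on_def)
  have R: "L2_loc_on S R"
    unfolding R_def using D[OF t] G by (rule L2_loc_on_vec_combination)
  have bound: "?I R \<le> 2 * ?I (Q h) + 2 * (norm (\<i> * of_real \<omega> - q h))\<^sup>2 * ?I (D t)" if h: "t + h > 0" for h
  proof -
    define Q' where "Q' x = q h *s D t x + (-1) *s G x" for x
    have Q': "L2_loc_on S Q'"
      unfolding Q'_def using D[OF t] G by (rule L2_loc_on_vec_combination)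
    have QL2: "L2_loc_on S (Q h)"
      unfolding Q_def by (intro L2_loc_on_difference_quotient D G t h)
    have "R x = 1 *s Q' x + (\<i> * of_real \<omega> - q h) *s D t x" for x
      by (simp add: R_def Q'_def vec_eq_iff algebra_simps)
    then have "?I R = ?I (\<lambda>x. 1 *s Q' x + (\<i> * of_real \<omega> - q h) *s D t x)"
      by simp
    also have "\<dots> \<le> 2 * (norm (1 :: complex))\<^sup>2 * ?I Q' + 2 * (norm (\<i> * of_real \<omega> - q h))\<^sup>2 * ?I (D t)"
      by (rule set_integral_norm_squared_combination_le[OF Q' D[OF t] K])
    also have "?I Q' = ?I (Q h)"
    proof -
      have "Q h x = Q' x" if "x \<in> K - {x \<in> S. D (t + h) x \<noteq> exp (\<i> * of_real \<omega> * of_real (t + h - t)) *s D t x}" for x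
      proof -
        have "D (t + h) x = exp (\<i> * of_real \<omega> * of_real h) *s D t x"
          using that K by auto
        then show ?thesis
          by (simp add: Q_def Q'_def q_def scaleR_eq_vector_scalar_mult vec_eq_iff diff_divide_distrib algebra_simps)
      qed
      then have "integral K (\<lambda>x. (norm (Q h x))\<^sup>2) = integral K (\<lambda>x. (norm (Q' x))\<^sup>2)"
        by (intro integral_spike[OF exponential[OF h]]) simp
      then show ?thesis
        using set_lebesgue_integral_eq_integral(2)[OF int[OF Q']]
          set_lebesgue_integral_eq_integral(2)[OF int[OF QL2]] by simp
    qed
    finally show ?thesis by simp
  qed
  have "((\<lambda>h. ?I (Q h)) \<longlongrightarrow> 0) (at 0)"
    using dD K by (auto simp: has_L2_loc_time_derivative_def Q_def)
  then have "((\<lambda>h. 2 * ?I (Q h) + 2 * (norm (\<i> * of_real \<omega> - q h))\<^sup>2 * ?I (D t)) \<longlongrightarrow>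
      2 * 0 + 2 * (norm (\<i> * of_real \<omega> - \<i> * of_real \<omega>))\<^sup>2 * ?I (D t)) (at 0)"
    unfolding q_def by (intro tendsto_intros exp_difference_quotient_tendsto)
  then have "((\<lambda>h. 2 * ?I (Q h) + 2 * (norm (\<i> * of_real \<omega> - q h))\<^sup>2 * ?I (D t)) \<longlongrightarrow> 0) (at 0)"
    by simp
  then have "?I R \<le> 0"
    by (rule tendsto_lowerbound) (auto intro!: eventually_mono[OF eventually_at_0_add_pos[OF t]] bound)
  moreover have "0 \<le> ?I R"
    by (auto simp: set_lebesgue_integral_def intro!: integral_nonneg_AE)
  ultimately have "integral\<^sup>L lebesgue (\<lambda>x. indicator K x *\<^sub>R (norm (R x))\<^sup>2) = 0"
    unfolding set_lebesgue_integral_def by (rule antisym)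
  then have "AE x in lebesgue. indicator K x *\<^sub>R (norm (R x))\<^sup>2 = 0"
    using int[OF R] unfolding set_integrable_def
    by (subst (asm) integral_nonneg_eq_0_iff_AE) auto
  then have "negligible {x. indicator K x *\<^sub>R (norm (R x))\<^sup>2 \<noteq> 0}"
    unfolding negligible_iff_null_sets AE_iff_null_sets completion.AE_iff_null_sets
    by (auto simp: completion.complete_measure_axioms)
  moreover have "G x = (\<i> * of_real \<omega>) *s D t x" if "R x = 0" for x
    using that by (simp add: R_def vec_eq_iff)
  ultimately show "negligible {x \<in> cbox c d. G x \<noteq> (\<i> * of_real \<omega>) *s D t x}"
    by (elim negligible_subset) (auto simp: K_def)
qed

section \<open>Linearity and time invariance of the system\<close>

lemma has_side_limit_combination:
  "has_side_limit e S v x l \<Longrightarrow> has_side_limit e S w x m \<Longrightarrow>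
   has_side_limit e S (\<lambda>x. a * v x + b * w x) x (a * l + b * m)"
  unfolding has_side_limit_def by (intro tendsto_intros)

lemma has_side_normal_derivative_combination:
  assumes v: "has_side_normal_derivative e S v x l" and w: "has_side_normal_derivative e S w x m"
  shows "has_side_normal_derivative e S (\<lambda>x. a * v x + b * w x) x (a * l + b * m)"
proof -
  let ?p = "\<lambda>s. x + (e * s) *\<^sub>R outward_normal S x"
  let ?d = "\<lambda>w s. frechet_derivative w (at (?p s)) (outward_normal S x)"
  have deriv: "((\<lambda>x. a * v x + b * w x) has_derivative
      (\<lambda>n. a * frechet_derivative v (at y) n + b * frechet_derivative w (at y) n)) (at y)"
    if "v differentiable at y" "w differentiable at y" for y
    using that by (intro has_derivative_add has_derivative_mult_right)
      (simp_all add: frechet_derivative_works[THEN iffD1])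
  have both: "\<forall>\<^sub>F s in at_right 0. v differentiable at (?p s) \<and> w differentiable at (?p s)"
    using v w by (auto simp: has_side_normal_derivative_def intro: eventually_conj)
  have "\<forall>\<^sub>F s in at_right 0. (\<lambda>x. a * v x + b * w x) differentiable at (?p s)"
    using both by eventually_elim (auto simp: differentiable_def intro: deriv[unfolded differentiable_def])
  moreover have "((\<lambda>s. a * ?d v s + b * ?d w s) \<longlongrightarrow> a * l + b * m) (at_right 0)"
    using v w unfolding has_side_normal_derivative_def by (intro tendsto_intros) auto
  then have "((\<lambda>s. ?d (\<lambda>x. a * v x + b * w x) s) \<longlongrightarrow> a * l + b * m) (at_right 0)"
  proof (rule tendsto_cong[THEN iffD1, rotated])
    show "\<forall>\<^sub>F s in at_right 0. a * ?d v s + b * ?d w s = ?d (\<lambda>x. a * v x + b * w x) s"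
      using both by eventually_elim (simp add: frechet_derivative_at[OF deriv, symmetric])
  qed
  ultimately show ?thesis
    by (simp add: has_side_normal_derivative_def)
qed

lemma skin_conditions_combination:
  assumes "skin_conditions S \<xi> v" "skin_conditions S \<xi> w"
  shows "skin_conditions S \<xi> (\<lambda>x. a * v x + b * w x)"
  unfolding skin_conditions_def
proof
  fix x assume "x \<in> frontier S"
  with assms obtain v_out v_in dv w_out w_in dw where
    v: "has_side_limit 1 S v x v_out" "has_side_limit (-1) S v x v_in"
      "has_side_normal_derivative 1 S v x dv" "v_out - v_in = of_real \<xi> * dv"
      "has_side_normal_derivative (-1) S v x 0" and
    w: "has_side_limit 1 S w x w_out" "has_side_limit (-1) S w x w_in"
      "has_side_normal_derivative 1 S w x dw" "w_out - w_in = of_real \<xi> * dw"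
      "has_side_normal_derivative (-1) S w x 0"
    unfolding skin_conditions_def by meson
  have "(a * v_out + b * w_out) - (a * v_in + b * w_in) = a * (v_out - v_in) + b * (w_out - w_in)"
    by (simp add: algebra_simps)
  also have "\<dots> = of_real \<xi> * (a * dv + b * dw)"
    unfolding v(4) w(4) by (simp add: algebra_simps)
  finally show "\<exists>w_out w_in d_out.
      has_side_limit 1 S (\<lambda>x. a * v x + b * w x) x w_out \<and>
      has_side_limit (-1) S (\<lambda>x. a * v x + b * w x) x w_in \<and>
      has_side_normal_derivative 1 S (\<lambda>x. a * v x + b * w x) x d_out \<and>
      w_out - w_in = of_real \<xi> * d_out \<and>
      has_side_normal_derivative (-1) S (\<lambda>x. a * v x + b * w x) x 0"
    using has_side_limit_combination[OF v(1) w(1), of a b] has_side_limit_combination[OF v(2) w(2), of a b]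
      has_side_normal_derivative_combination[OF v(3) w(3), of a b]
      has_side_normal_derivative_combination[OF v(5) w(5), of a b]
    by auto
qed

lemma decays_at_infinity_combination:
  assumes "decays_at_infinity v" "decays_at_infinity w"
  shows "decays_at_infinity (\<lambda>x. a * v x + b * w x)"
proof -
  have "(\<lambda>x. norm a * norm (v x) + norm b * norm (w x)) \<in> O[at_infinity](\<lambda>x. inverse (norm x))"
    using assms unfolding decays_at_infinity_def by (intro sum_in_bigo) simp_all
  moreover have "(\<lambda>x. norm (a * v x + b * w x)) \<in> O[at_infinity](\<lambda>x. norm a * norm (v x) + norm b * norm (w x))"
  proof (intro landau_o.big_mono always_eventually allI)
    show "norm (norm (a * v x + b * w x)) \<le> norm (norm a * norm (v x) + norm b * norm (w x))" for x
      using norm_triangle_ineq[of "a * v x" "b * w x"] by (simp add: norm_mult)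
  qed
  ultimately show ?thesis
    unfolding decays_at_infinity_def by (rule landau_o.big_trans[rotated])
qed

lemma conduction_time_eq_on_combination:
  assumes "conduction_time_eq_on S \<sigma> \<epsilon> u" "conduction_time_eq_on S \<sigma> \<epsilon> v"
  shows "conduction_time_eq_on S \<sigma> \<epsilon> (\<lambda>x t. a * u x t + b * v x t)"
proof -
  obtain Du dtDu where u: "\<And>t. t > 0 \<Longrightarrow> weak_gradient_on S (\<lambda>x. u x t) (Du t)"
    "\<And>t. t > 0 \<Longrightarrow> has_L2_loc_time_derivative S Du t (dtDu t)"
    "\<And>t. t > 0 \<Longrightarrow> weak_div_free_on S (\<lambda>x. \<sigma> x *\<^sub>R Du t x + \<epsilon> x *\<^sub>R dtDu t x)"
    using assms(1) unfolding conduction_time_eq_on_def by auto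
  obtain Dv dtDv where v: "\<And>t. t > 0 \<Longrightarrow> weak_gradient_on S (\<lambda>x. v x t) (Dv t)"
    "\<And>t. t > 0 \<Longrightarrow> has_L2_loc_time_derivative S Dv t (dtDv t)"
    "\<And>t. t > 0 \<Longrightarrow> weak_div_free_on S (\<lambda>x. \<sigma> x *\<^sub>R Dv t x + \<epsilon> x *\<^sub>R dtDv t x)"
    using assms(2) unfolding conduction_time_eq_on_def by auto
  have L2: "L2_loc_on S (Du t)" "L2_loc_on S (Dv t)" if "t > 0" for t
    using u(1)[OF that] v(1)[OF that] by (auto simp: weak_gradient_on_def)
  have "weak_div_free_on S (\<lambda>x. \<sigma> x *\<^sub>R (a *s Du t x + b *s Dv t x) + \<epsilon> x *\<^sub>R (a *s dtDu t x + b *s dtDv t x))"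
    if "t > 0" for t
  proof -
    have "weak_div_free_on S (\<lambda>x. a *s (\<sigma> x *\<^sub>R Du t x + \<epsilon> x *\<^sub>R dtDu t x) + b *s (\<sigma> x *\<^sub>R Dv t x + \<epsilon> x *\<^sub>R dtDv t x))"
      using u(3)[OF that] v(3)[OF that] by (rule weak_div_free_on_combination)
    also have "(\<lambda>x. a *s (\<sigma> x *\<^sub>R Du t x + \<epsilon> x *\<^sub>R dtDu t x) + b *s (\<sigma> x *\<^sub>R Dv t x + \<epsilon> x *\<^sub>R dtDv t x)) =
        (\<lambda>x. \<sigma> x *\<^sub>R (a *s Du t x + b *s Dv t x) + \<epsilon> x *\<^sub>R (a *s dtDu t x + b *s dtDv t x))"
      by (simp add: fun_eq_iff vec_eq_iff scaleR_conv_of_real algebra_simps)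
    finally show ?thesis .
  qed
  moreover have "weak_gradient_on S (\<lambda>x. a * u x t + b * v x t) (\<lambda>x. a *s Du t x + b *s Dv t x)" if "t > 0" for t
    using u(1)[OF that] v(1)[OF that] by (rule weak_gradient_on_combination)
  moreover have "has_L2_loc_time_derivative S (\<lambda>t x. a *s Du t x + b *s Dv t x) t (\<lambda>x. a *s dtDu t x + b *s dtDv t x)"
    if "t > 0" for t
    using L2 that u(2)[OF that] v(2)[OF that] by (rule has_L2_loc_time_derivative_combination)
  ultimately show ?thesis
    unfolding conduction_time_eq_on_def
    by (intro exI[of _ "\<lambda>t x. a *s Du t x + b *s Dv t x"] exI[of _ "\<lambda>t x. a *s dtDu t x + b *s dtDv t x"]) auto
qed

text \<open>
  Only delays \<open>s \<ge> 0\<close> are possible: the equation is required at positive times.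
\<close>

lemma conduction_time_eq_on_shift:
  assumes "conduction_time_eq_on S \<sigma> \<epsilon> u" "s \<ge> 0"
  shows "conduction_time_eq_on S \<sigma> \<epsilon> (\<lambda>x t. u x (t + s))"
proof -
  obtain Du dtDu where "\<forall>t>0. weak_gradient_on S (\<lambda>x. u x t) (Du t) \<and>
        has_L2_loc_time_derivative S Du t (dtDu t) \<and>
        weak_div_free_on S (\<lambda>x. \<sigma> x *\<^sub>R Du t x + \<epsilon> x *\<^sub>R dtDu t x)"
    using assms(1) unfolding conduction_time_eq_on_def by auto
  moreover have "has_L2_loc_time_derivative S (\<lambda>t. Du (t + s)) t (dtDu (t + s))"
    if "has_L2_loc_time_derivative S Du (t + s) (dtDu (t + s))" for t
    using that by (simp add: has_L2_loc_time_derivative_def add_ac)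
  ultimately show ?thesis
    using assms(2) unfolding conduction_time_eq_on_def
    by (intro exI[of _ "\<lambda>t. Du (t + s)"] exI[of _ "\<lambda>t. dtDu (t + s)"]) auto
qed

text \<open>
  The point distributions \<open>f1\<close> and \<open>f2\<close> are the same in both systems; superposition acts on their
  time profiles.
\<close>

lemma solves_system_combination:
  assumes "solves_system \<Omega>1 \<Omega>2 P \<sigma> \<epsilon> \<xi>1 \<xi>2 f1 f2 h1 h2 u"
    and "solves_system \<Omega>1 \<Omega>2 P \<sigma> \<epsilon> \<xi>1 \<xi>2 f1 f2 k1 k2 v"
  shows "solves_system \<Omega>1 \<Omega>2 P \<sigma> \<epsilon> \<xi>1 \<xi>2 f1 f2 (\<lambda>t. a * h1 t + b * k1 t) (\<lambda>t. a * h2 t + b * k2 t)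
    (\<lambda>x t. a * u x t + b * v x t)"
proof -
  have src: "laplace_eq_on S (\<lambda>x. a * u x t + b * v x t) (\<lambda>\<phi>. f \<phi> * (a * h t + b * k t))"
    if "laplace_eq_on S (\<lambda>x. u x t) (\<lambda>\<phi>. f \<phi> * h t)" "laplace_eq_on S (\<lambda>x. v x t) (\<lambda>\<phi>. f \<phi> * k t)"
    for S f h k t
    using laplace_eq_on_combination[OF that, of a b] by (simp add: algebra_simps)
  show ?thesis
    using assms unfolding solves_system_def
    by (intro conjI allI impI continuous_on_add continuous_on_mult continuous_on_const src
        conduction_time_eq_on_combination skin_conditions_combination decays_at_infinity_combination) simp_all
qed

lemma solves_system_shift:
  assumes "solves_system \<Omega>1 \<Omega>2 P \<sigma> \<epsilon> \<xi>1 \<xi>2 f1 f2 h1 h2 u" "s \<ge> 0"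
  shows "solves_system \<Omega>1 \<Omega>2 P \<sigma> \<epsilon> \<xi>1 \<xi>2 f1 f2 (\<lambda>t. h1 (t + s)) (\<lambda>t. h2 (t + s)) (\<lambda>x t. u x (t + s))"
  using assms unfolding solves_system_def by (auto intro: conduction_time_eq_on_shift)

section \<open>Separation of the frequencies\<close>

text \<open>
  The amplitudes \<open>c1\<close> and \<open>c2\<close> allow one statement for both frequencies: with amplitudes 1 and 0 it
  yields the first transmission problem, with 0 and 1 the second. The source points lie inside the
  bodies, so every exterior point is regular and the pointwise formula for \<open>v\<close> holds on the whole
  exterior domain; this is what makes weak gradients at different times comparable there.
\<close>

lemma solves_transmission_problem_of_exponential:
  assumes v: "solves_system \<Omega>1 \<Omega>2 P \<sigma> \<epsilon> \<xi>1 \<xi>2 f1 f2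
      (\<lambda>t. c1 * exp (\<i> * of_real \<omega> * of_real t)) (\<lambda>t. c2 * exp (\<i> * of_real \<omega> * of_real t)) v"
    and P: "P \<subseteq> \<Omega>1 \<union> \<Omega>2"
    and separated: "\<And>x t. x \<in> regular_points \<Omega>1 \<Omega>2 P \<Longrightarrow> t > 0 \<Longrightarrow>
      v x t = exp (\<i> * of_real \<omega> * of_real (t - 1)) * v x 1"
  shows "solves_transmission_problem \<Omega>1 \<Omega>2 P \<sigma> \<epsilon> \<xi>1 \<xi>2 (\<lambda>\<phi>. c1 * f1 \<phi>) (\<lambda>\<phi>. c2 * f2 \<phi>) \<omega>
    (\<lambda>x. exp (- (\<i> * of_real \<omega>)) * v x 1)"
proof -
  define z where "z = exp (- (\<i> * of_real \<omega>))"
  define S where "S = exterior \<Omega>1 \<Omega>2"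
  have z: "z * exp (\<i> * of_real \<omega>) = 1"
    by (simp add: z_def exp_minus)
  have regular: "x \<in> regular_points \<Omega>1 \<Omega>2 P" if "x \<in> S" for x
    using that P closure_subset[of "\<Omega>1 \<union> \<Omega>2"]
    by (auto simp: S_def exterior_def regular_points_def frontier_def closure_Un)
  have "open S"
    unfolding S_def exterior_def by (intro open_Compl closed_closure)
  obtain Dv dtDv where D: "\<And>t. t > 0 \<Longrightarrow> weak_gradient_on S (\<lambda>x. v x t) (Dv t)"
    "\<And>t. t > 0 \<Longrightarrow> has_L2_loc_time_derivative S Dv t (dtDv t)"
    "\<And>t. t > 0 \<Longrightarrow> weak_div_free_on S (\<lambda>x. \<sigma> x *\<^sub>R Dv t x + \<epsilon> x *\<^sub>R dtDv t x)"
  proof -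
    have "conduction_time_eq_on S \<sigma> \<epsilon> v"
      using v by (simp add: solves_system_def S_def)
    then show ?thesis
      using that unfolding conduction_time_eq_on_def by auto
  qed
  have "negligible {x \<in> S. Dv t x \<noteq> exp (\<i> * of_real \<omega> * of_real (t - 1)) *s Dv 1 x}" if t: "t > 0" for t
  proof (rule weak_gradient_on_unique[OF \<open>open S\<close> D(1)[OF t]])
    let ?e = "exp (\<i> * of_real \<omega> * of_real (t - 1))"
    show "weak_gradient_on S (\<lambda>x. ?e * v x 1) (\<lambda>x. ?e *s Dv 1 x)"
      using weak_gradient_on_combination[OF D(1) D(1), of 1 1 ?e 0] by simp
    show "v x t = ?e * v x 1" if "x \<in> S" for x
      by (rule separated[OF regular[OF that] t])
  qed
  then have dt: "negligible {x \<in> S. dtDv 1 x \<noteq> (\<i> * of_real \<omega>) *s Dv 1 x}"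
    using D(1,2) by (intro L2_loc_time_derivative_of_exponential[OF \<open>open S\<close>])
      (auto simp: weak_gradient_on_def)
  have freq: "conduction_freq_eq_on S \<sigma> \<epsilon> \<omega> (\<lambda>x. z * v x 1)"
    unfolding conduction_freq_eq_on_def
  proof (intro exI conjI)
    show "weak_gradient_on S (\<lambda>x. z * v x 1) (\<lambda>x. z *s Dv 1 x)"
      using weak_gradient_on_combination[OF D(1) D(1), of 1 1 z 0] by simp
    have "weak_div_free_on S (\<lambda>x. z *s (\<sigma> x *\<^sub>R Dv 1 x + \<epsilon> x *\<^sub>R dtDv 1 x))"
      using weak_div_free_on_combination[OF D(3) D(3), of 1 1 z 0] by simp
    then show "weak_div_free_on S
        (\<lambda>x. (of_real (\<sigma> x) + \<i> * of_real \<omega> * of_real (\<epsilon> x)) *s (z *s Dv 1 x))"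
    proof (rule weak_div_free_on_spike)
      show "negligible {x \<in> S. z *s (\<sigma> x *\<^sub>R Dv 1 x + \<epsilon> x *\<^sub>R dtDv 1 x) \<noteq>
          (of_real (\<sigma> x) + \<i> * of_real \<omega> * of_real (\<epsilon> x)) *s (z *s Dv 1 x)}"
        by (rule negligible_subset[OF dt])
          (auto simp: scaleR_eq_vector_scalar_mult vec_eq_iff algebra_simps)
    qed
  qed
  have lap: "laplace_eq_on \<Omega> (\<lambda>x. z * v x 1) (\<lambda>\<phi>. c * f \<phi>)"
    if "laplace_eq_on \<Omega> (\<lambda>x. v x 1) (\<lambda>\<phi>. f \<phi> * (c * exp (\<i> * of_real \<omega> * of_real 1)))" for \<Omega> c f
  proof -
    have "z * (f \<phi> * (c * exp (\<i> * of_real \<omega>))) = (z * exp (\<i> * of_real \<omega>)) * (c * f \<phi>)" for \<phi>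
      by (simp only: mult_ac)
    with laplace_eq_on_combination[OF that that, of z 0] show ?thesis
      by (simp add: z)
  qed
  have skin: "skin_conditions \<Omega> \<xi> (\<lambda>x. z * v x 1)" if "skin_conditions \<Omega> \<xi> (\<lambda>x. v x 1)" for \<Omega> \<xi>
    using skin_conditions_combination[OF that that, of z 0] by simp
  have decay: "decays_at_infinity (\<lambda>x. z * v x 1)" if "decays_at_infinity (\<lambda>x. v x 1)"
    using decays_at_infinity_combination[OF that that, of z 0] by simp
  have cont: "continuous_on A (\<lambda>x. z * v x 1)" if "continuous_on A (\<lambda>x. v x 1)" for A
    using that by (intro continuous_intros)
  have "continuous_on (regular_points \<Omega>1 \<Omega>2 P) (\<lambda>x. v x 1)"
    "laplace_eq_on \<Omega>1 (\<lambda>x. v x 1) (\<lambda>\<phi>. f1 \<phi> * (c1 * exp (\<i> * of_real \<omega> * of_real 1)))"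
    "laplace_eq_on \<Omega>2 (\<lambda>x. v x 1) (\<lambda>\<phi>. f2 \<phi> * (c2 * exp (\<i> * of_real \<omega> * of_real 1)))"
    "skin_conditions \<Omega>1 \<xi>1 (\<lambda>x. v x 1)" "skin_conditions \<Omega>2 \<xi>2 (\<lambda>x. v x 1)"
    "decays_at_infinity (\<lambda>x. v x 1)"
    using v zero_less_one[where 'a = real] unfolding solves_system_def by blast+
  then show ?thesis
    unfolding solves_transmission_problem_def z_def[symmetric] S_def[symmetric]
    by (intro conjI cont lap freq skin decay)
qed

lemma admissible_class_combination:
  "admissible_class \<U> \<Longrightarrow> v \<in> \<U> \<Longrightarrow> w \<in> \<U> \<Longrightarrow> (\<lambda>x t. a * v x t + b * w x t) \<in> \<U>"
  unfolding admissible_class_def by simp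

lemma admissible_class_shift:
  "admissible_class \<U> \<Longrightarrow> v \<in> \<U> \<Longrightarrow> s \<ge> 0 \<Longrightarrow> (\<lambda>x t. v x (t + s)) \<in> \<U>"
  unfolding admissible_class_def by simp

lemma exp_i_add:
  "exp (\<i> * of_real \<omega> * of_real (s + t)) = exp (\<i> * of_real \<omega> * of_real s) * exp (\<i> * of_real \<omega> * of_real t)"
  by (simp add: exp_add[symmetric] algebra_simps)

text \<open>
  With a single frequency, delaying by \<open>s\<close> and multiplying by \<open>e s\<close> have the same effect on the
  forcing. The difference of the two results is a source-free admissible solution, which may be added
  to \<open>u\<close> and hence is zero by uniqueness.
\<close>

lemma single_frequency_solution_exponential:
  fixes \<U> :: "(real^2 \<Rightarrow> real \<Rightarrow> complex) set" and \<omega> :: real and c1 c2 :: complex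
  defines "e \<equiv> \<lambda>t :: real. exp (\<i> * of_real \<omega> * of_real t)"
  assumes adm: "admissible_class \<U>"
    and u: "u \<in> \<U>" "solves_system \<Omega>1 \<Omega>2 P \<sigma> \<epsilon> \<xi>1 \<xi>2 f1 f2 h1 h2 u"
    and unique: "\<And>v. v \<in> \<U> \<Longrightarrow> solves_system \<Omega>1 \<Omega>2 P \<sigma> \<epsilon> \<xi>1 \<xi>2 f1 f2 h1 h2 v \<Longrightarrow>
              \<forall>x\<in>regular_points \<Omega>1 \<Omega>2 P. \<forall>t>0. v x t = u x t"
    and v: "v \<in> \<U>" "solves_system \<Omega>1 \<Omega>2 P \<sigma> \<epsilon> \<xi>1 \<xi>2 f1 f2 (\<lambda>t. c1 * e t) (\<lambda>t. c2 * e t) v"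
    and x: "x \<in> regular_points \<Omega>1 \<Omega>2 P" and t: "t > 0"
  shows "v x t = e (t - 1) * v x 1"
proof -
  have shift: "v x (t + s) = e s * v x t" if "t > 0" "s \<ge> 0" for t s
  proof -
    define d where "d = (\<lambda>x t. 1 * v x (t + s) + (- e s) * v x t)"
    have e_add: "e (t + s) = e t * e s" for t
      unfolding e_def by (rule exp_i_add)
    have vs: "(\<lambda>x t. v x (t + s)) \<in> \<U>"
      by (rule admissible_class_shift[OF adm v(1) \<open>s \<ge> 0\<close>])
    have "d \<in> \<U>"
      unfolding d_def by (rule admissible_class_combination[OF adm vs v(1)])
    then have "(\<lambda>x t. 1 * u x t + 1 * d x t) \<in> \<U>"
      by (rule admissible_class_combination[OF adm u(1)])
    moreover have "solves_system \<Omega>1 \<Omega>2 P \<sigma> \<epsilon> \<xi>1 \<xi>2 f1 f2 (\<lambda>t. 0) (\<lambda>t. 0) d"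
      using solves_system_combination[OF solves_system_shift[OF v(2) \<open>s \<ge> 0\<close>] v(2), of 1 "- e s"]
      by (simp add: d_def e_add algebra_simps)
    then have "solves_system \<Omega>1 \<Omega>2 P \<sigma> \<epsilon> \<xi>1 \<xi>2 f1 f2 h1 h2 (\<lambda>x t. 1 * u x t + 1 * d x t)"
      using solves_system_combination[OF u(2), of "\<lambda>t. 0" "\<lambda>t. 0" d 1 1] by simp
    ultimately have "1 * u x t + 1 * d x t = u x t"
      using unique x \<open>t > 0\<close> by blast
    then show ?thesis
      by (simp add: d_def)
  qed
  have inv: "e (t - 1) * e (1 - t) = 1"
    unfolding e_def exp_i_add[symmetric] by simp
  show ?thesis
  \<comment> \<open>Delays are nonnegative, so times before 1 are reached by delaying from \<open>t\<close> to 1 and inverting the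
    phase.\<close>
  proof (cases "t \<ge> 1")
    case True
    then show ?thesis
      using shift[of 1 "t - 1"] by simp
  next
    case False
    then have "v x 1 = e (1 - t) * v x t"
      using shift[of t "1 - t"] t by simp
    then have "e (t - 1) * v x 1 = (e (t - 1) * e (1 - t)) * v x t"
      by simp
    then show ?thesis
      by (simp add: inv)
  qed
qed

text \<open>
  With \<open>z1\<close> and \<open>z2\<close> the phases acquired during the delay \<open>s\<close>, the combination \<open>u (t + s) - z2 * u t\<close>
  cancels the second source and keeps \<open>z1 - z2\<close> times the first; \<open>u (t + s) - z1 * u t\<close> does the
  opposite. Dividing by \<open>z1 - z2\<close> and \<open>z2 - z1\<close> gives \<open>v1\<close> and \<open>v2\<close>.
\<close>

lemma split_frequencies:
  fixes \<U> :: "(real^2 \<Rightarrow> real \<Rightarrow> complex) set"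
  defines "e \<equiv> \<lambda>\<omega> t :: real. exp (\<i> * of_real \<omega> * of_real t)"
  assumes "\<omega>1 \<noteq> \<omega>2" and adm: "admissible_class \<U>"
    and u: "u \<in> \<U>" "solves_system \<Omega>1 \<Omega>2 P \<sigma> \<epsilon> \<xi>1 \<xi>2 f1 f2 (e \<omega>1) (e \<omega>2) u"
  obtains v1 v2 where "v1 \<in> \<U>" "v2 \<in> \<U>" "\<And>x t. u x t = v1 x t + v2 x t"
    "solves_system \<Omega>1 \<Omega>2 P \<sigma> \<epsilon> \<xi>1 \<xi>2 f1 f2 (e \<omega>1) (\<lambda>_. 0) v1"
    "solves_system \<Omega>1 \<Omega>2 P \<sigma> \<epsilon> \<xi>1 \<xi>2 f1 f2 (\<lambda>_. 0) (e \<omega>2) v2"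
proof -
  \<comment> \<open>During this delay the phase difference of the oscillations changes by \<open>pi\<close>, so \<open>z1 = - z2\<close>.\<close>
  define s where "s = pi / \<bar>\<omega>1 - \<omega>2\<bar>"
  have s: "s \<ge> 0"
    by (simp add: s_def)
  define z1 z2 where "z1 = e \<omega>1 s" and "z2 = e \<omega>2 s"
  have "z1 \<noteq> z2"
  proof
    assume "z1 = z2"
    then have "exp (\<i> * of_real ((\<omega>1 - \<omega>2) * s)) = 1"
      by (simp add: z1_def z2_def e_def algebra_simps exp_diff)
    then have "cos ((\<omega>1 - \<omega>2) * s) = 1"
      by (metis cis_conv_exp cis.sel(1) one_complex.sel(1))
    moreover have "(\<omega>1 - \<omega>2) * s = pi \<or> (\<omega>1 - \<omega>2) * s = - pi"
      using \<open>\<omega>1 \<noteq> \<omega>2\<close> unfolding s_def by (simp add: abs_if divide_eq_eq eq_divide_eq algebra_simps)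
    then have "cos ((\<omega>1 - \<omega>2) * s) = -1"
      by (elim disjE) simp_all
    ultimately show False
      by simp
  qed
  have e_add: "e \<omega> (t + s) = e \<omega> t * e \<omega> s" for \<omega> t
    unfolding e_def by (rule exp_i_add)
  define c where "c = 1 / (z1 - z2)"
  have c: "c * (z1 - z2) = 1"
    using \<open>z1 \<noteq> z2\<close> by (simp add: c_def)
  have c': "c * z1 = 1 + c * z2"
    using c by (simp add: algebra_simps)
  define v1 where "v1 = (\<lambda>x t. c * u x (t + s) + (- c * z2) * u x t)"
  define v2 where "v2 = (\<lambda>x t. (- c) * u x (t + s) + (c * z1) * u x t)"
  have us: "(\<lambda>x t. u x (t + s)) \<in> \<U>"
    by (rule admissible_class_shift[OF adm u(1) s])
  show thesis
  proof
    show "v1 \<in> \<U>" "v2 \<in> \<U>"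
      unfolding v1_def v2_def by (rule admissible_class_combination[OF adm us u(1)])+
    show "u x t = v1 x t + v2 x t" for x t
      by (simp add: v1_def v2_def c' algebra_simps)
    note comb = solves_system_combination[OF solves_system_shift[OF u(2) s] u(2)]
    have "c * (y * z1) + (- c * z2) * y = y" "c * (y * z2) + (- c * z2) * y = 0"
      "(- c) * (y * z1) + (c * z1) * y = 0" "(- c) * (y * z2) + (c * z1) * y = y" for y
    proof -
      have "c * (y * z1) + (- c * z2) * y = (c * (z1 - z2)) * y"
        "(- c) * (y * z2) + (c * z1) * y = (c * (z1 - z2)) * y"
        by (simp_all add: algebra_simps)
      then show "c * (y * z1) + (- c * z2) * y = y" "(- c) * (y * z2) + (c * z1) * y = y"
        by (simp_all only: c mult_1)
    qed simp_all
    then show "solves_system \<Omega>1 \<Omega>2 P \<sigma> \<epsilon> \<xi>1 \<xi>2 f1 f2 (e \<omega>1) (\<lambda>_. 0) v1"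
      "solves_system \<Omega>1 \<Omega>2 P \<sigma> \<epsilon> \<xi>1 \<xi>2 f1 f2 (\<lambda>_. 0) (e \<omega>2) v2"
      using comb[of c "- c * z2"] comb[of "- c" "c * z1"]
      unfolding e_add v1_def v2_def z1_def[symmetric] z2_def[symmetric] by (simp_all only:)
  qed
qed

theorem proposition2p1:
  fixes \<Omega>1 \<Omega>2 P :: "(real^2) set"
    and \<sigma> \<epsilon> :: "real^2 \<Rightarrow> real"
    and \<xi>1 \<xi>2 \<omega>1 \<omega>2 :: real
    and \<alpha>1 \<alpha>2 :: "nat \<Rightarrow> complex"
    and p1 p2 :: "nat \<Rightarrow> real^2"
    and f1 f2 :: distribution
    and h1 h2 :: "real \<Rightarrow> complex"
    and \<U> :: "(real^2 \<Rightarrow> real \<Rightarrow> complex) set"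
    and u :: "real^2 \<Rightarrow> real \<Rightarrow> complex"
  defines "f1 \<equiv> dipole \<alpha>1 p1"
    and "f2 \<equiv> dipole \<alpha>2 p2"
    and "h1 \<equiv> (\<lambda>t. exp (\<i> * of_real \<omega>1 * of_real t))"
    and "h2 \<equiv> (\<lambda>t. exp (\<i> * of_real \<omega>2 * of_real t))"
    and "P \<equiv> {p1 1, p1 2, p2 1, p2 2}"
  assumes "fish_body \<Omega>1" and "fish_body \<Omega>2" and "\<Omega>1 \<inter> \<Omega>2 = {}"
    and "p1 1 \<in> \<Omega>1" and "p1 2 \<in> \<Omega>1" and "\<alpha>1 1 + \<alpha>1 2 = 0"
    and "p2 1 \<in> \<Omega>2" and "p2 2 \<in> \<Omega>2" and "\<alpha>2 1 + \<alpha>2 2 = 0"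
    and "\<omega>1 \<noteq> \<omega>2" and "\<omega>1 \<noteq> 0" and "\<omega>2 \<noteq> 0"
    and "admissible_class \<U>"
    and "u \<in> \<U>"
    and "solves_system \<Omega>1 \<Omega>2 P \<sigma> \<epsilon> \<xi>1 \<xi>2 f1 f2 h1 h2 u"
    and "\<And>v. v \<in> \<U> \<Longrightarrow> solves_system \<Omega>1 \<Omega>2 P \<sigma> \<epsilon> \<xi>1 \<xi>2 f1 f2 h1 h2 v \<Longrightarrow>
              \<forall>x\<in>regular_points \<Omega>1 \<Omega>2 P. \<forall>t>0. v x t = u x t"
  shows "\<exists>u1 u2.
           (\<forall>x\<in>regular_points \<Omega>1 \<Omega>2 P. \<forall>t>0.
              u x t = u1 x * exp (\<i> * of_real \<omega>1 * of_real t)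
                    + u2 x * exp (\<i> * of_real \<omega>2 * of_real t)) \<and>
           solves_transmission_problem \<Omega>1 \<Omega>2 P \<sigma> \<epsilon> \<xi>1 \<xi>2 f1 (\<lambda>_. 0) \<omega>1 u1 \<and>
           solves_transmission_problem \<Omega>1 \<Omega>2 P \<sigma> \<epsilon> \<xi>1 \<xi>2 (\<lambda>_. 0) f2 \<omega>2 u2"
proof -
  let ?e = "\<lambda>\<omega> t :: real. exp (\<i> * of_real \<omega> * of_real t) :: complex"
  have sys: "solves_system \<Omega>1 \<Omega>2 P \<sigma> \<epsilon> \<xi>1 \<xi>2 f1 f2 (?e \<omega>1) (?e \<omega>2) u"
    using \<open>solves_system \<Omega>1 \<Omega>2 P \<sigma> \<epsilon> \<xi>1 \<xi>2 f1 f2 h1 h2 u\<close> by (simp add: h1_def h2_def)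
  have P: "P \<subseteq> \<Omega>1 \<union> \<Omega>2"
    using assms by (auto simp: P_def)
  obtain v1 v2 where v: "v1 \<in> \<U>" "v2 \<in> \<U>" "\<And>x t. u x t = v1 x t + v2 x t"
    and v1: "solves_system \<Omega>1 \<Omega>2 P \<sigma> \<epsilon> \<xi>1 \<xi>2 f1 f2 (?e \<omega>1) (\<lambda>_. 0) v1"
    and v2: "solves_system \<Omega>1 \<Omega>2 P \<sigma> \<epsilon> \<xi>1 \<xi>2 f1 f2 (\<lambda>_. 0) (?e \<omega>2) v2"
    using split_frequencies[OF \<open>\<omega>1 \<noteq> \<omega>2\<close> \<open>admissible_class \<U>\<close> \<open>u \<in> \<U>\<close> sys] by blast
  have v1': "solves_system \<Omega>1 \<Omega>2 P \<sigma> \<epsilon> \<xi>1 \<xi>2 f1 f2 (\<lambda>t. 1 * ?e \<omega>1 t) (\<lambda>t. 0 * ?e \<omega>1 t) v1"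
    and v2': "solves_system \<Omega>1 \<Omega>2 P \<sigma> \<epsilon> \<xi>1 \<xi>2 f1 f2 (\<lambda>t. 0 * ?e \<omega>2 t) (\<lambda>t. 1 * ?e \<omega>2 t) v2"
    using v1 v2 by simp_all
  note separated = single_frequency_solution_exponential[OF \<open>admissible_class \<U>\<close> \<open>u \<in> \<U>\<close>
      \<open>solves_system \<Omega>1 \<Omega>2 P \<sigma> \<epsilon> \<xi>1 \<xi>2 f1 f2 h1 h2 u\<close> assms(21)]
  have sep1: "v1 x t = ?e \<omega>1 (t - 1) * v1 x 1" and sep2: "v2 x t = ?e \<omega>2 (t - 1) * v2 x 1"
    if "x \<in> regular_points \<Omega>1 \<Omega>2 P" "t > 0" for x t
    using separated[OF _ _ v(1) v1' that] separated[OF _ _ v(2) v2' that] by blast+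
  have e_minus: "?e \<omega> (t - 1) = exp (- (\<i> * of_real \<omega>)) * ?e \<omega> t" for \<omega> t
    by (simp add: exp_add[symmetric] algebra_simps)
  show ?thesis
  proof (intro exI conjI ballI allI impI)
    show "u x t = (exp (- (\<i> * of_real \<omega>1)) * v1 x 1) * ?e \<omega>1 t + (exp (- (\<i> * of_real \<omega>2)) * v2 x 1) * ?e \<omega>2 t"
      if "x \<in> regular_points \<Omega>1 \<Omega>2 P" "t > 0" for x t
      unfolding v(3) sep1[OF that] sep2[OF that] e_minus by simp
    show "solves_transmission_problem \<Omega>1 \<Omega>2 P \<sigma> \<epsilon> \<xi>1 \<xi>2 f1 (\<lambda>_. 0) \<omega>1
        (\<lambda>x. exp (- (\<i> * of_real \<omega>1)) * v1 x 1)"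
      using solves_transmission_problem_of_exponential[OF v1' P sep1] by simp
    show "solves_transmission_problem \<Omega>1 \<Omega>2 P \<sigma> \<epsilon> \<xi>1 \<xi>2 (\<lambda>_. 0) f2 \<omega>2
        (\<lambda>x. exp (- (\<i> * of_real \<omega>2)) * v2 x 1)"
      using solves_transmission_problem_of_exponential[OF v2' P sep2] by simp
  qed
qed

end
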